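(* Let $\mathbf{F}$ be a finite field with $q$ elements, let $n \ge 1$, let $k$ be a field in which $q$ is nonzero, and let $0 \le r \le n-1$. Define \[ \eta_r \;=\; q^{-(n-1)r}\,\mu(r)\sum_{m} \mu(\mathrm{srk}\, m)\,\binom{n-1-\operatorname{rank} m}{r-\operatorname{rank} m}_{q}\,[m]\ \in k[\mathfrak{M}_n], \] where the sum runs over all semi-idempotent matrices $m\in\mathfrak{M}_n$ with $\operatorname{rank} m\le r$. Then $\eta_r$ is the unit (two-sided identity element) of the ideal $\mathfrak{a}_{n,r}$.
   Context: $\mathfrak{M}_n$ is the monoid of $n\times n$ matrices over $\mathbf{F}$ under multiplication, and $k[\mathfrak{M}_n]$ its monoid algebra over $k$ with basis $\{[m] : m\in\mathfrak{M}_n\}$ and $[m][m']=[mm']$. $\mathfrak{a}_{n,r}$ is the two-sided ideal of $k[\mathfrak{M}_n]$ spanned by $[m]$ with $\operatorname{rank} m \le r$. A matrix (or linear operator $T$ on a finite-dimensional $\mathbf{F}$-space $V$) is semi-idempotent if there is a decomposition $V=X\oplus Y$ into $T$-stable subspaces with $T|_X$ the identity and $T|_Y$ nilpotent (equivalently, $T$ acts as the identity on $\operatorname{im} T^N$ for $N\gg0$). The stable rank $\mathrm{srk}\, m$ is the rank of $m^i$ for $i\gg 0$. $\mu(i)=(-1)^i q^{\binom{i}{2}}$. The $q$-binomial coefficient is $\binom{a}{b}_q=\frac{[a]_q!}{[b]_q![a-b]_q!}$ with $[a]_q!=\prod_{i=1}^a \frac{q^i-1}{q-1}$. *)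

theory Defs
  imports "Jordan_Normal_Form.DL_Rank"
begin

definition mat_rank :: "nat \<Rightarrow> 'f::field mat \<Rightarrow> nat" where
  "mat_rank n m = vec_space.rank n m"

text \<open>Semi-idempotent: m acts as the identity on the image of m^N for some (hence all large) N.\<close>
definition semi_idempotent :: "'f::field mat \<Rightarrow> bool" where
  "semi_idempotent m \<longleftrightarrow> (\<exists>N. m * (m ^\<^sub>m N) = m ^\<^sub>m N)"

definition stable_rank :: "nat \<Rightarrow> 'f::field mat \<Rightarrow> nat" where
  "stable_rank n m = (THE s. \<exists>N. \<forall>i\<ge>N. mat_rank n (m ^\<^sub>m i) = s)"

definition mu :: "nat \<Rightarrow> nat \<Rightarrow> 'k::field" where
  "mu q i = (-1) ^ i * of_nat q ^ (i choose 2)"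

text \<open>q-factorial [a]_q! = prod_{i=1..a} (q^i-1)/(q-1), computed exactly in nat (q >= 2),
  and the q-binomial [a]_q!/([b]_q! [a-b]_q!) (an integer), for b <= a.\<close>
definition qfact :: "nat \<Rightarrow> nat \<Rightarrow> nat" where
  "qfact q a = (\<Prod>i=1..a. (q ^ i - 1) div (q - 1))"

definition qbinom :: "nat \<Rightarrow> nat \<Rightarrow> nat \<Rightarrow> nat" where
  "qbinom q a b = qfact q a div (qfact q b * qfact q (a - b))"

text \<open>The monoid algebra k[M_n]: k-valued functions on n x n matrices (finite support automatic),
  with [m] the indicator of m and multiplication the convolution.\<close>
definition monoid_alg :: "nat \<Rightarrow> ('f::field mat \<Rightarrow> 'k::field) set" where
  "monoid_alg n = {a. \<forall>m. m \<notin> carrier_mat n n \<longrightarrow> a m = 0}"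

definition conv :: "nat \<Rightarrow> ('f::field mat \<Rightarrow> 'k::field) \<Rightarrow> ('f mat \<Rightarrow> 'k) \<Rightarrow> ('f mat \<Rightarrow> 'k)" where
  "conv n a b = (\<lambda>m. \<Sum>p \<in> {(x, y). x \<in> carrier_mat n n \<and> y \<in> carrier_mat n n \<and> x * y = m}.
                       a (fst p) * b (snd p))"

definition rank_ideal :: "nat \<Rightarrow> nat \<Rightarrow> ('f::field mat \<Rightarrow> 'k::field) set" where
  "rank_ideal n r = {a \<in> monoid_alg n. \<forall>m \<in> carrier_mat n n. r < mat_rank n m \<longrightarrow> a m = 0}"

definition is_unit_of_ideal :: "nat \<Rightarrow> ('f::field mat \<Rightarrow> 'k::field) set \<Rightarrow> ('f mat \<Rightarrow> 'k) \<Rightarrow> bool" where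
  "is_unit_of_ideal n I e \<longleftrightarrow> e \<in> I \<and> (\<forall>x \<in> I. conv n e x = x \<and> conv n x e = x)"

definition eta :: "'f::{field,finite} itself \<Rightarrow> nat \<Rightarrow> nat \<Rightarrow> ('f mat \<Rightarrow> 'k::field)" where
  "eta (t::'f itself) n r = (\<lambda>m. if m \<in> carrier_mat n n \<and> semi_idempotent m \<and> mat_rank n m \<le> r
      then inverse (of_nat (card (UNIV :: 'f set)) ^ ((n - 1) * r)) * mu (card (UNIV :: 'f set)) r
           * mu (card (UNIV :: 'f set)) (stable_rank n m)
           * of_nat (qbinom (card (UNIV :: 'f set)) (n - 1 - mat_rank n m) (r - mat_rank n m))
      else 0)"

end

theory Submission
  imports Defs
begin

text \<open>
  Let \<open>psi m\<close> be \<open>mu (srk m)\<close> for semi-idempotent \<open>m\<close> and \<open>0\<close> otherwise. It is a trace-like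
  function: \<open>psi (A B) = psi (B A)\<close> even for rectangular \<open>A\<close>, \<open>B\<close>. The key fact is that
  \<open>psi\<close> sums to zero over every family \<open>M + c b\<close>, where \<open>b\<close> is a fixed nonzero row and \<open>c\<close> runs
  over all columns. The family consists of the extensions to the whole space of a fixed map \<open>G\<close>
  on the hyperplane \<open>ker b\<close>. If \<open>G\<close> is not injective, factor through the quotient by a line of
  \<open>ker G\<close>. If \<open>G\<close> is injective, every extension of larger rank is invertible, hence
  contributes only if it is the identity; the others are \<open>G (p + x b)\<close> for a projection \<open>p\<close> onto
  the hyperplane, and swapping the factors turns their sum into one of the same kind,
  one dimension lower.

  The swapping argument also evaluates the sum over the extensions of the same rank as \<open>G\<close>, so
  weights depending on the rank can be inserted. Pascal's rule for q-binomials then makes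
  the sum of \<open>psi m binom(n-1-rk m, r-rk m) Phi(m B)\<close> drop to dimension \<open>n - 1\<close> as long as
  \<open>r < n - 1\<close>, for any \<open>B\<close> with at most \<open>r\<close> columns; it ends at \<open>r = n - 1\<close> with a multiple of
  \<open>Phi(B)\<close>. Factoring \<open>y = B C\<close> shows that \<open>eta\<close> is a left unit, and \<open>eta\<close> is invariant under
  transposition.
\<close>

subsection \<open>Matrices and ranks over a finite field\<close>

lemma bij_betw_carrier_mat:
  "bij_betw (\<lambda>f. mat nr nc f) (({..<nr} \<times> {..<nc}) \<rightarrow>\<^sub>E UNIV) (carrier_mat nr nc)"
proof (rule bij_betw_byWitness[where f' = "\<lambda>A. restrict (\<lambda>ij. A $$ ij) ({..<nr} \<times> {..<nc})"])
  show "\<forall>f\<in>({..<nr} \<times> {..<nc}) \<rightarrow>\<^sub>E UNIV. restrict (\<lambda>ij. mat nr nc f $$ ij) ({..<nr} \<times> {..<nc}) = f"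
    by (auto simp: PiE_def extensional_def fun_eq_iff restrict_def)
qed (auto split: if_splits)

lemma finite_carrier_mat [simp]: "finite (carrier_mat nr nc :: 'a::finite mat set)"
  using bij_betw_finite[OF bij_betw_carrier_mat[of nr nc, where 'a='a]] by (simp add: finite_PiE)

lemma card_carrier_mat: "card (carrier_mat nr nc :: 'a::finite mat set) = card (UNIV :: 'a set) ^ (nr * nc)"
  using bij_betw_same_card[OF bij_betw_carrier_mat[of nr nc, where 'a='a]]
  by (simp add: card_PiE)

text \<open>Dimension conditions are stated as equations, which the simplifier can discharge without
  guessing carriers.\<close>

lemma mult_mat_assoc:
  fixes A B C :: "'a::semiring_0 mat"
  assumes "dim_col A = dim_row B" "dim_col B = dim_row C"
  shows "(A * B) * C = A * (B * C)"
  by (rule assoc_mult_mat[of A "dim_row A" "dim_col A" B "dim_col B" C "dim_col C"])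
    (rule carrier_matI; use assms in metis)+

lemma mult_mat_distrib_right:
  fixes A B C :: "'a::semiring_0 mat"
  assumes "dim_row A = dim_row B" "dim_col A = dim_row C" "dim_col B = dim_row C"
  shows "(A + B) * C = A * C + B * C"
  by (rule add_mult_distrib_mat[of A "dim_row A" "dim_col A" B C "dim_col C"])
    (rule carrier_matI; use assms in metis)+

lemma mult_mat_distrib_left:
  fixes A B C :: "'a::semiring_0 mat"
  assumes "dim_row B = dim_row C" "dim_col B = dim_col C" "dim_col A = dim_row B"
  shows "A * (B + C) = A * B + A * C"
  by (rule mult_add_distrib_mat[of A "dim_row A" "dim_col A" B "dim_col B" C])
    (rule carrier_matI; use assms in metis)+

text \<open>\<open>B\<close> collects a maximal independent set of columns of \<open>A\<close>,
  \<open>C\<close> expresses all columns of \<open>A\<close> in it, and \<open>E\<close> selects it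
  from \<open>A\<close>. Injectivity is stated on one-column matrices, so that later arguments use
  matrix products only.\<close>

lemma rank_factorization:
  fixes A :: "'a::field mat"
  assumes A: "A \<in> carrier_mat n k"
  obtains B C E where "B \<in> carrier_mat n (mat_rank n A)" "C \<in> carrier_mat (mat_rank n A) k"
    "E \<in> carrier_mat k (mat_rank n A)" "A = B * C" "B = A * E"
    "inj_on ((*) B) (carrier_mat (mat_rank n A) 1)"
proof -
  interpret vec_space "TYPE('a)" n .
  obtain S where S: "finite S" "maximal S (\<lambda>T. T \<subseteq> set (cols A) \<and> lin_indpt T)"
    using maximal_exists_superset[of "set (cols A)" "\<lambda>T. T \<subseteq> set (cols A) \<and> lin_indpt T" "{}"]
    using finite_lin_indpt2 by auto
  have Sc: "S \<subseteq> set (cols A)" and ind: "lin_indpt S" using S(2) unfolding maximal_def by auto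
  have colsA: "set (cols A) \<subseteq> carrier_vec n" using A cols_dim by blast
  hence Sn: "S \<subseteq> carrier_vec n" using Sc by blast
  obtain xs where xs: "set xs = S" "distinct xs" using finite_distinct_list[OF S(1)] by blast
  define t where "t = mat_rank n A"
  have t: "length xs = t" unfolding t_def mat_rank_def rank_card_indpt[OF A S(2)]
    using distinct_card[OF xs(2)] xs(1) by simp
  define B where "B = mat_of_cols n xs"
  have B: "B \<in> carrier_mat n t" unfolding B_def t[symmetric] by simp
  have colsB: "cols B = xs" unfolding B_def using xs Sn by simp
  have span: "x \<in> span S" if "x \<in> set (cols A)" for x
  proof (rule ccontr)
    assume n: "x \<notin> span S"
    have "x \<notin> S" using n span_mem[OF Sn] by blast
    hence "lin_indpt (insert x S)" using lin_dep_iff_in_span[OF Sn ind, of x] n that colsA by auto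
    hence "insert x S = S" using S(2) that Sc unfolding maximal_def by blast
    thus False using n span_mem[OF Sn] by blast
  qed
  have ex: "\<exists>v. v \<in> carrier_vec t \<and> B *\<^sub>v v = col A j" if "j < k" for j
  proof -
    have "col A j \<in> span S" using span A that by (metis carrier_matD(2) cols_length cols_nth nth_mem)
    then obtain a where "lincomb a S = col A j" using finite_in_span[OF S(1) Sn] by metis
    thus ?thesis using mat_mult_eq_lincomb[OF B, of a] colsB xs by (metis vec_carrier)
  qed
  then obtain f where f: "\<And>j. j < k \<Longrightarrow> f j \<in> carrier_vec t \<and> B *\<^sub>v f j = col A j" by metis
  define C where "C = mat_of_cols t (map f [0..<k])"
  have C: "C \<in> carrier_mat t k" unfolding C_def by (rule carrier_matI) auto
  have colC: "col C j = f j" if "j < k" for j unfolding C_def using that f by simp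
  have ABC: "A = B * C"
  proof (rule mat_col_eqI)
    fix j assume "j < dim_col (B * C)"
    hence j: "j < k" using C by simp
    show "col A j = col (B * C) j"
      using col_mult2[OF B C j] colC[OF j] f[OF j] by metis
  qed (use A B C in auto)
  have "\<exists>i<k. col A i = xs ! j" if "j < t" for j
  proof -
    have "xs ! j \<in> set (cols A)" using Sc xs t that nth_mem by blast
    thus ?thesis using A by (metis carrier_matD(2) cols_length cols_nth in_set_conv_nth)
  qed
  then obtain g where g: "\<And>j. j < t \<Longrightarrow> g j < k \<and> col A (g j) = xs ! j" by metis
  \<comment> \<open>Column \<open>g j\<close> of \<open>A\<close> is column \<open>j\<close> of
    \<open>B\<close>, so unit vectors pick out \<open>B\<close>.\<close>
  define E :: "'a mat" where "E = mat_of_cols k (map (\<lambda>j. unit_vec k (g j)) [0..<t])"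
  have E: "E \<in> carrier_mat k t" unfolding E_def by (rule carrier_matI) auto
  have BAE: "B = A * E"
  proof (rule mat_col_eqI)
    fix j assume "j < dim_col (A * E)"
    hence j: "j < t" using E by simp
    have "col (A * E) j = A *\<^sub>v col E j" by (rule col_mult2[OF A E j])
    also have "col E j = unit_vec k (g j)" unfolding E_def using j g by simp
    also have "A *\<^sub>v unit_vec k (g j) = col A (g j)" by (rule eq_vecI) (use A g[OF j, THEN conjunct1] in auto)
    also have "\<dots> = col B j" using g[OF j] using j B colsB by (metis carrier_matD(2) cols_length cols_nth)
    finally show "col B j = col (A * E) j" by simp
  qed (use A B E in auto)
  have inj: "inj_on ((*) B) (carrier_mat t 1)"
  proof (rule inj_onI)
    fix X Y assume X: "X \<in> carrier_mat t 1" and Y: "Y \<in> carrier_mat t 1" and eq: "B * X = B * Y"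
    have "B *\<^sub>v (col X 0 - col Y 0) = B *\<^sub>v col X 0 - B *\<^sub>v col Y 0"
      by (rule mult_minus_distrib_mat_vec[OF B]) (use X Y in auto)
    also have "\<dots> = col (B * X) 0 - col (B * Y) 0" using col_mult2[OF B X] col_mult2[OF B Y] by simp
    also have "\<dots> = 0\<^sub>v n" using eq B by auto
    finally have "B *\<^sub>v (col X 0 - col Y 0) = 0\<^sub>v n" .
    moreover have "col X 0 - col Y 0 \<in> carrier_vec t" by (rule carrier_vecI) (use Y in simp)
    ultimately have "col X 0 - col Y 0 = 0\<^sub>v t"
      using lin_depI[OF B, of "col X 0 - col Y 0"] X Y ind colsB xs by auto
    hence z: "(col X 0 - col Y 0) $ i = 0" if "i < t" for i using that by simp
    show "X = Y"
    proof (rule eq_matI)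
      fix i j assume "i < dim_row Y" "j < dim_col Y"
      thus "X $$ (i, j) = Y $$ (i, j)" using z[of i] X Y by auto
    qed (use X Y in auto)
  qed
  show ?thesis using that[of B C E] B C E ABC BAE inj unfolding t_def by blast
qed


section \<open>Ranks by counting column spaces\<close>

definition col_image :: "'a::semiring_0 mat \<Rightarrow> 'a mat set" where
  "col_image A = (*) A ` carrier_mat (dim_col A) 1"

lemma col_image_carrier:
  "A \<in> carrier_mat n k \<Longrightarrow> col_image A \<subseteq> carrier_mat n 1"
  by (auto simp: col_image_def)

lemma finite_col_image [simp]: "finite (col_image (A :: 'a::{semiring_0,finite} mat))"
  by (simp add: col_image_def)

lemma col_image_mult_subset:
  assumes "dim_col A = dim_row B"
  shows "col_image (A * B) \<subseteq> col_image A"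
proof
  fix Y assume "Y \<in> col_image (A * B)"
  then obtain X where X: "X \<in> carrier_mat (dim_col B) 1" "Y = A * B * X"
    by (auto simp: col_image_def)
  hence "Y = A * (B * X)" using assms by (simp add: mult_mat_assoc)
  moreover have "B * X \<in> carrier_mat (dim_col A) 1" using X assms by (intro carrier_matI) auto
  ultimately show "Y \<in> col_image A" unfolding col_image_def by blast
qed

lemma col_image_mult:
  assumes "dim_col A = dim_row B"
  shows "col_image (A * B) = (*) A ` col_image B"
  unfolding col_image_def image_image using assms by (intro image_cong) (auto simp: mult_mat_assoc)

text \<open>\<open>A\<close> and \<open>B\<close> are right multiples of each other, so they share a
  column space, and injectivity of \<open>B\<close> counts it.\<close>

lemma card_col_image:
  fixes A :: "'a::{field,finite} mat"
  assumes A: "A \<in> carrier_mat n k"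
  shows "card (col_image A) = card (UNIV :: 'a set) ^ mat_rank n A"
proof -
  obtain B C E where BCE: "B \<in> carrier_mat n (mat_rank n A)" "C \<in> carrier_mat (mat_rank n A) k"
    "E \<in> carrier_mat k (mat_rank n A)" "A = B * C" "B = A * E"
    "inj_on ((*) B) (carrier_mat (mat_rank n A) 1)"
    using rank_factorization[OF A] .
  have "col_image A \<subseteq> col_image B" unfolding BCE(4)
    by (rule col_image_mult_subset) (use BCE(1,2) in auto)
  moreover have "col_image B \<subseteq> col_image A" unfolding BCE(5)
    by (rule col_image_mult_subset) (use BCE(3) A in auto)
  ultimately have "col_image A = col_image B" by simp
  thus ?thesis using card_image[OF BCE(6)] BCE(1) by (simp add: col_image_def card_carrier_mat)
qed

lemma card_field_ge_2: "card (UNIV :: 'a::{field,finite} set) \<ge> 2"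
  using card_mono[of "UNIV :: 'a set" "{0, 1}"] by simp

text \<open>As the field has at least two elements, powers of its size are strictly monotone in the
  exponent; rank inequalities become statements about images of finite sets.\<close>

lemma mat_rank_le_iff:
  fixes A B :: "'a::{field,finite} mat"
  assumes "A \<in> carrier_mat n k" "B \<in> carrier_mat m l"
  shows "mat_rank n A \<le> mat_rank m B \<longleftrightarrow> card (col_image A) \<le> card (col_image B)"
  unfolding card_col_image[OF assms(1)] card_col_image[OF assms(2)]
  using card_field_ge_2[where 'a='a] by simp

lemma mat_rank_mult_le_left:
  fixes A B :: "'a::{field,finite} mat"
  assumes "A \<in> carrier_mat n k" "B \<in> carrier_mat k l"
  shows "mat_rank n (A * B) \<le> mat_rank n A"
  using assms by (subst mat_rank_le_iff) (auto intro!: card_mono col_image_mult_subset)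

lemma mat_rank_mult_le_right:
  fixes A B :: "'a::{field,finite} mat"
  assumes "A \<in> carrier_mat n k" "B \<in> carrier_mat k l"
  shows "mat_rank n (A * B) \<le> mat_rank k B"
  using assms by (subst mat_rank_le_iff) (auto simp: col_image_mult intro!: card_image_le)

lemma mat_rank_le_cols:
  fixes A :: "'a::{field,finite} mat"
  assumes "A \<in> carrier_mat n k"
  shows "mat_rank n A \<le> k"
proof -
  have "card (col_image A) \<le> card (UNIV :: 'a set) ^ k"
    unfolding col_image_def using card_image_le[of "carrier_mat k 1" "(*) A"] assms
    by (simp add: card_carrier_mat)
  thus ?thesis unfolding card_col_image[OF assms] using card_field_ge_2[where 'a='a] by simp
qed

lemma mat_rank_inj:
  fixes A :: "'a::{field,finite} mat"
  assumes "A \<in> carrier_mat n k"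
  shows "mat_rank n A = k \<longleftrightarrow> inj_on ((*) A) (carrier_mat k 1)"
proof -
  have "inj_on ((*) A) (carrier_mat k 1) \<longleftrightarrow> card (col_image A) = card (UNIV :: 'a set) ^ k"
    unfolding col_image_def using inj_on_iff_eq_card[of "carrier_mat k 1" "(*) A"] assms
    by (simp add: card_carrier_mat)
  thus ?thesis unfolding card_col_image[OF assms] using card_field_ge_2[where 'a='a] by simp
qed

text \<open>Transposing \<open>A = B * C\<close> puts the transpose of \<open>C\<close> on the left,
  which has only \<open>mat_rank n A\<close> columns.\<close>

lemma mat_rank_transpose_le:
  fixes A :: "'a::{field,finite} mat"
  assumes A: "A \<in> carrier_mat n k"
  shows "mat_rank k (transpose_mat A) \<le> mat_rank n A"
proof -
  obtain B C E where BCE: "B \<in> carrier_mat n (mat_rank n A)" "C \<in> carrier_mat (mat_rank n A) k"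
    "A = B * C" using rank_factorization[OF A] by metis
  have "transpose_mat A = transpose_mat C * transpose_mat B"
    unfolding BCE(3) by (rule transpose_mult[OF BCE(1,2)])
  hence "mat_rank k (transpose_mat A) \<le> mat_rank k (transpose_mat C)"
    using mat_rank_mult_le_left[of "transpose_mat C" k "mat_rank n A" "transpose_mat B" n] BCE by simp
  also have "\<dots> \<le> mat_rank n A" by (rule mat_rank_le_cols) (use BCE in simp)
  finally show ?thesis .
qed

lemma mat_rank_transpose:
  fixes A :: "'a::{field,finite} mat"
  assumes "A \<in> carrier_mat n k"
  shows "mat_rank k (transpose_mat A) = mat_rank n A"
  using mat_rank_transpose_le[OF assms] mat_rank_transpose_le[of "transpose_mat A" k n] assms by simp

lemma add_zero_mat_dim:
  fixes A :: "'a::monoid_add mat"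
  assumes "dim_row A = nr" "dim_col A = nc"
  shows "0\<^sub>m nr nc + A = A" "A + 0\<^sub>m nr nc = A"
  using assms by (auto intro!: eq_matI)

lemma mult_zero_mat_dim:
  fixes A :: "'a::semiring_0 mat"
  shows "dim_col A = nr \<Longrightarrow> A * 0\<^sub>m nr nc = 0\<^sub>m (dim_row A) nc"
    and "dim_row A = nc \<Longrightarrow> 0\<^sub>m nr nc * A = 0\<^sub>m nr (dim_col A)"
  by (auto intro!: eq_matI simp: scalar_prod_def)

lemma mult_one_mat_dim:
  fixes A :: "'a::semiring_1 mat"
  shows "dim_row A = n \<Longrightarrow> 1\<^sub>m n * A = A" and "dim_col A = n \<Longrightarrow> A * 1\<^sub>m n = A"
  by (auto intro!: left_mult_one_mat right_mult_one_mat carrier_matI)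

subsection \<open>Splitting off a line\<close>

text \<open>A splitting of \<open>F^(k+1)\<close> into a hyperplane and a line: \<open>s\<close> and \<open>v\<close> are the
  inclusions of the two summands, \<open>p\<close> and \<open>b\<close> the projections onto them.\<close>
locale splitting =
  fixes k :: nat and s p b v :: "'a::field mat"
  assumes carrier: "s \<in> carrier_mat (Suc k) k" "p \<in> carrier_mat k (Suc k)"
      "b \<in> carrier_mat 1 (Suc k)" "v \<in> carrier_mat (Suc k) 1"
    and ps: "p * s = 1\<^sub>m k" and bv: "b * v = 1\<^sub>m 1"
    and pv: "p * v = 0\<^sub>m k 1" and bs: "b * s = 0\<^sub>m 1 k"
    and sum: "s * p + v * b = 1\<^sub>m (Suc k)"
begin

lemma dims [simp]:
  "dim_row s = Suc k" "dim_col s = k" "dim_row p = k" "dim_col p = Suc k"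
  "dim_row b = 1" "dim_col b = Suc k" "dim_row v = Suc k" "dim_col v = 1"
  using carrier by auto

end

text \<open>Transposition exchanges inclusions and projections; it turns a splitting built from a
  column into one built from a row.\<close>

lemma splitting_transpose:
  assumes "splitting k s p b v"
  shows "splitting k (transpose_mat p) (transpose_mat s) (transpose_mat v) (transpose_mat b)"
proof -
  interpret splitting k s p b v by fact
  have *: "transpose_mat (A * B) = transpose_mat B * transpose_mat A"
    if "dim_col A = dim_row B" for A B :: "'a mat"
    using that by (intro transpose_mult[of A _ "dim_row B"]) auto
  show ?thesis
  proof
    show "transpose_mat s * transpose_mat p = 1\<^sub>m k" using ps by (simp flip: *)
    show "transpose_mat v * transpose_mat b = 1\<^sub>m 1" using bv by (simp flip: *)
    show "transpose_mat s * transpose_mat b = 0\<^sub>m k 1" using bs by (simp flip: *)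
    show "transpose_mat v * transpose_mat p = 0\<^sub>m 1 k" using pv by (simp flip: *)
    have "transpose_mat (s * p) + transpose_mat (v * b) = 1\<^sub>m (Suc k)"
      using sum by (subst transpose_add[symmetric, of _ "Suc k" "Suc k"]) (auto intro: carrier_matI)
    thus "transpose_mat p * transpose_mat s + transpose_mat b * transpose_mat v = 1\<^sub>m (Suc k)"
      by (simp add: *)
  qed auto
qed

text \<open>Choose a coordinate \<open>j\<close> where \<open>v\<close> is nonzero. Then
  \<open>s\<close> includes the hyperplane where this coordinate vanishes, \<open>b\<close> reads
  off the multiple of \<open>v\<close>, and \<open>p\<close> subtracts that multiple and deletes
  coordinate \<open>j\<close>.\<close>

lemma ex_splitting_col:
  fixes v :: "'a::field mat"
  assumes v: "v \<in> carrier_mat (Suc k) 1" "v \<noteq> 0\<^sub>m (Suc k) 1"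
  obtains s p b where "splitting k s p b v"
proof -
  obtain j where j: "j < Suc k" "v $$ (j, 0) \<noteq> 0"
    using v by (metis (no_types, lifting) carrier_matD eq_matI index_zero_mat less_one)
  \<comment> \<open>\<open>\<sigma>\<close> enumerates the indices other than \<open>j\<close> in
    increasing order.\<close>
  define \<sigma> where "\<sigma> i = (if i < j then i else Suc i)" for i
  have \<sigma>: "\<sigma> i \<noteq> j" "\<sigma> i = \<sigma> i' \<longleftrightarrow> i = i'" "i < k \<Longrightarrow> \<sigma> i < Suc k"
    "i < k \<Longrightarrow> k \<noteq> \<sigma> i \<Longrightarrow> \<sigma> i < k" for i i'
    by (auto simp: \<sigma>_def)
  have \<sigma>_surj: "\<exists>i<k. a = \<sigma> i" if "a < Suc k" "a \<noteq> j" for a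
    using that j by (intro exI[of _ "if a < j then a else a - 1"]) (auto simp: \<sigma>_def)
  define s :: "'a mat" where "s = mat (Suc k) k (\<lambda>(a, i). if a = \<sigma> i then 1 else 0)"
  define b :: "'a mat" where "b = mat 1 (Suc k) (\<lambda>(_, a). if a = j then 1 / v $$ (j, 0) else 0)"
  define p :: "'a mat" where "p = mat k (Suc k) (\<lambda>(i, a). (if a = \<sigma> i then 1 else 0) -
      (if a = j then v $$ (\<sigma> i, 0) / v $$ (j, 0) else 0))"
  note defs = s_def b_def p_def
  have "splitting k s p b v"
  proof
    show "p * s = 1\<^sub>m k"
      by (rule eq_matI) (use \<sigma> j in \<open>auto simp: defs scalar_prod_def left_diff_distrib sum_subtractf if_distrib[of "\<lambda>x. x * _"] sum.delta cong: if_cong\<close>)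
    show "b * v = 1\<^sub>m 1"
      by (rule eq_matI) (use \<sigma> j v in \<open>auto simp: defs scalar_prod_def if_distrib[of "\<lambda>x. x * _"] sum.delta cong: if_cong\<close>)
    show "b * s = 0\<^sub>m 1 k"
      by (rule eq_matI) (use \<sigma> j v in \<open>auto simp: defs scalar_prod_def if_distrib[of "\<lambda>x. x * _"] sum.delta cong: if_cong\<close>)
    show "p * v = 0\<^sub>m k 1"
      by (rule eq_matI) (use \<sigma> j v in \<open>auto simp: defs scalar_prod_def left_diff_distrib sum_subtractf if_distrib[of "\<lambda>x. x * _"] sum.delta cong: if_cong\<close>)
    show "s * p + v * b = 1\<^sub>m (Suc k)"
    proof (rule eq_matI)
      fix a c assume "a < dim_row (1\<^sub>m (Suc k) :: 'a mat)" "c < dim_col (1\<^sub>m (Suc k) :: 'a mat)"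
      hence ac: "a < Suc k" "c < Suc k" by auto
      have vb: "(v * b) $$ (a, c) = (if c = j then v $$ (a, 0) / v $$ (j, 0) else 0)"
        using ac v by (simp add: defs scalar_prod_def)
      \<comment> \<open>Row \<open>j\<close> comes from \<open>v * b\<close> alone; any other row
        has index \<open>\<sigma> i\<close>, where \<open>s * p\<close> copies row \<open>i\<close>
        of \<open>p\<close>.\<close>
      show "(s * p + v * b) $$ (a, c) = 1\<^sub>m (Suc k) $$ (a, c)"
      proof (cases "a = j")
        case True
        hence "(s * p) $$ (a, c) = 0" using ac \<sigma>(1)[symmetric] by (auto simp: defs scalar_prod_def intro!: sum.neutral)
        thus ?thesis using True vb ac j v by (auto simp: defs)
      next
        case False
        then obtain i where i: "i < k" "a = \<sigma> i" using \<sigma>_surj ac by blast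
        have "p \<in> carrier_mat k (Suc k)" by (simp add: p_def)
        hence "(s * p) $$ (a, c) = (\<Sum>i'<k. (if i = i' then p $$ (i', c) else 0))"
          using ac i \<sigma>(2) by (auto simp: s_def scalar_prod_def lessThan_atLeast0 if_distrib[of "\<lambda>x. x * _"] cong: if_cong)
        also have "\<dots> = p $$ (i, c)" using i by simp
        finally show ?thesis using vb ac i \<sigma>(1)[of i] v by (auto simp: defs)
      qed
    qed (use v in \<open>auto simp: defs\<close>)
  qed (use v in \<open>auto simp: defs\<close>)
  thus ?thesis using that by blast
qed

lemma ex_splitting_row:
  fixes b :: "'a::field mat"
  assumes b: "b \<in> carrier_mat 1 (Suc k)" "b \<noteq> 0\<^sub>m 1 (Suc k)"
  obtains s p v where "splitting k s p b v"
proof -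
  have "transpose_mat b \<noteq> 0\<^sub>m (Suc k) 1" using b(2)
    by (metis transpose_transpose zero_transpose_mat)
  then obtain s p v where "splitting k s p v (transpose_mat b)"
    using ex_splitting_col[of "transpose_mat b" k] b by auto
  from splitting_transpose[OF this] show ?thesis using that by simp
qed


context splitting
begin

text \<open>Products are reassociated to the right, so the four relations are also needed in front
  of a further factor.\<close>

lemma left_cancel:
  "dim_row X = k \<Longrightarrow> p * (s * X) = X"
  "dim_row X = 1 \<Longrightarrow> b * (v * X) = X"
  "dim_row X = 1 \<Longrightarrow> p * (v * X) = 0\<^sub>m k (dim_col X)"
  "dim_row X = k \<Longrightarrow> b * (s * X) = 0\<^sub>m 1 (dim_col X)"
  by (simp_all flip: mult_mat_assoc add: ps bv pv bs mult_zero_mat_dim mult_one_mat_dim)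

lemmas splitting_simps = left_cancel ps bv pv bs mult_mat_assoc mult_mat_distrib_left
  mult_mat_distrib_right add_zero_mat_dim mult_zero_mat_dim mult_one_mat_dim

lemma decompose_right':
  assumes "dim_col M = Suc k"
  shows "M * (s * p) + M * (v * b) = M"
proof -
  have "M * (s * p) + M * (v * b) = M * (s * p + v * b)"
    using assms by (simp add: mult_mat_distrib_left)
  also have "\<dots> = M" unfolding sum using assms by (simp add: mult_one_mat_dim)
  finally show ?thesis .
qed

lemma decompose_right: "dim_col M = Suc k \<Longrightarrow> M * s * p + M * v * b = M"
  using decompose_right'[of M] by (simp add: mult_mat_assoc)

lemma decompose_left:
  assumes "dim_row M = Suc k"
  shows "s * (p * M) + v * (b * M) = M"
proof -
  have "s * (p * M) + v * (b * M) = (s * p + v * b) * M"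
    using assms by (simp add: mult_mat_assoc mult_mat_distrib_right)
  also have "\<dots> = M" unfolding sum using assms by (simp add: mult_one_mat_dim)
  finally show ?thesis .
qed

text \<open>A matrix is determined by its restriction \<open>M * s\<close> to the hyperplane and its
  value \<open>M * v\<close> on the line, both arbitrary.\<close>

lemma sum_decompose_right:
  "(\<Sum>M\<in>carrier_mat l (Suc k). f M) =
    (\<Sum>G\<in>carrier_mat l k. \<Sum>c\<in>carrier_mat l 1. f (G * p + c * b))"
  unfolding sum.cartesian_product
  by (rule sum.reindex_bij_witness[where i = "\<lambda>(G, c). G * p + c * b" and j = "\<lambda>M. (M * s, M * v)"])
    (auto simp: splitting_simps decompose_right' intro!: carrier_matI)

lemma sum_decompose_left:
  "(\<Sum>M\<in>carrier_mat (Suc k) l. f M) =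
    (\<Sum>X\<in>carrier_mat k l. \<Sum>Y\<in>carrier_mat 1 l. f (s * X + v * Y))"
  unfolding sum.cartesian_product
  by (rule sum.reindex_bij_witness[where i = "\<lambda>(X, Y). s * X + v * Y" and j = "\<lambda>M. (p * M, b * M)"])
    (auto simp: splitting_simps decompose_left intro!: carrier_matI)


lemma mult_col_right:
  assumes "dim_col G = k" "dim_col c = 1" "dim_row c = dim_row G"
  shows "(G * p + c * b) * s = G" "(G * p + c * b) * v = c"
  using assms by (simp_all add: splitting_simps)

end

section \<open>Column space and rank of an extension from the hyperplane\<close>

lemma mat_1x1_eq_iff:
  "X \<in> carrier_mat 1 1 \<Longrightarrow> Y \<in> carrier_mat 1 1 \<Longrightarrow> X = Y \<longleftrightarrow> X $$ (0, 0) = Y $$ (0, 0)"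
  by (auto intro!: eq_matI)

text \<open>If two sums agree with different \<open>Y\<close>, dividing by the difference
  \<open>d\<close> expresses \<open>c\<close> through the columns of \<open>G\<close>.\<close>

lemma inj_on_col_image_sum:
  fixes G c :: "'a::field mat"
  assumes G: "G \<in> carrier_mat l k" and c: "c \<in> carrier_mat l 1" "c \<notin> col_image G"
  shows "inj_on (\<lambda>(Z, Y). Z + c * Y) (col_image G \<times> carrier_mat 1 1)"
proof (rule inj_onI, clarify)
  fix Z Y Z' Y' :: "'a mat"
  assume Z: "Z \<in> col_image G" "Z' \<in> col_image G" and Y: "Y \<in> carrier_mat 1 1" "Y' \<in> carrier_mat 1 1"
    and eq: "Z + c * Y = Z' + c * Y'"
  obtain X X' where X: "X \<in> carrier_mat k 1" "X' \<in> carrier_mat k 1" "Z = G * X" "Z' = G * X'"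
    using Z G by (auto simp: col_image_def)
  define d where "d = Y $$ (0, 0) - Y' $$ (0, 0)"
  have ent: "(G * X) $$ (i, 0) + c $$ (i, 0) * Y $$ (0, 0) = (G * X') $$ (i, 0) + c $$ (i, 0) * Y' $$ (0, 0)"
    if "i < l" for i
  proof -
    have "(G * X + c * Y) $$ (i, 0) = (G * X' + c * Y') $$ (i, 0)" using eq X by simp
    thus ?thesis using that X Y G c by (simp add: scalar_prod_def)
  qed
  have "d = 0"
  proof (rule ccontr)
    assume d: "d \<noteq> 0"
    have "c = inverse d \<cdot>\<^sub>m (G * (X' - X))"
    proof (rule eq_matI)
      fix i j assume "i < dim_row (inverse d \<cdot>\<^sub>m (G * (X' - X)))" "j < dim_col (inverse d \<cdot>\<^sub>m (G * (X' - X)))"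
      hence ij: "i < l" "j = 0" using G X by auto
      have "G * (X' - X) = G * X' - G * X" by (rule mult_minus_distrib_mat[OF G X(2,1)])
      hence "(G * (X' - X)) $$ (i, 0) = (G * X') $$ (i, 0) - (G * X) $$ (i, 0)" using ij G X by simp
      also have "\<dots> = d * c $$ (i, 0)" using ent[OF ij(1)] by (simp add: d_def algebra_simps)
      finally show "c $$ (i, j) = (inverse d \<cdot>\<^sub>m (G * (X' - X))) $$ (i, j)"
        using ij G X d by simp
    qed (use G X c in auto)
    also have "\<dots> = G * (inverse d \<cdot>\<^sub>m (X' - X))"
      by (rule mult_smult_distrib[symmetric, OF G]) (use X in auto)
    finally have "c = G * (inverse d \<cdot>\<^sub>m (X' - X))" .
    moreover have "inverse d \<cdot>\<^sub>m (X' - X) \<in> carrier_mat k 1" using X by (intro carrier_matI) auto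
    ultimately have "c \<in> col_image G" using G unfolding col_image_def by blast
    thus False using c by simp
  qed
  hence Y': "Y = Y'" using Y by (simp add: mat_1x1_eq_iff d_def)
  have "G * X = G * X'"
    by (rule eq_matI) (use ent G X Y' in \<open>auto simp del: index_mult_mat(1)\<close>)
  thus "Z = Z' \<and> Y = Y'" using Y' X by simp
qed

locale finite_splitting = splitting k s p b v for k and s p b v :: "'a::{field,finite} mat"
begin

lemma col_image_append:
  assumes G: "G \<in> carrier_mat l k" and c: "c \<in> carrier_mat l 1"
  shows "col_image (G * p + c * b) = (\<lambda>(Z, Y). Z + c * Y) ` (col_image G \<times> carrier_mat 1 1)"
proof (intro equalityI subsetI)
  fix W assume "W \<in> col_image (G * p + c * b)"
  then obtain X where X: "X \<in> carrier_mat (Suc k) 1" "W = (G * p + c * b) * X"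
    by (auto simp: col_image_def)
  hence "W = G * (p * X) + c * (b * X)" using G c by (simp add: splitting_simps)
  moreover have "G * (p * X) \<in> col_image G" "b * X \<in> carrier_mat 1 1"
    using X G by (auto simp: col_image_def intro!: imageI carrier_matI)
  ultimately show "W \<in> (\<lambda>(Z, Y). Z + c * Y) ` (col_image G \<times> carrier_mat 1 1)" by force
next
  fix W assume "W \<in> (\<lambda>(Z, Y). Z + c * Y) ` (col_image G \<times> carrier_mat 1 1)"
  then obtain X Y where XY: "X \<in> carrier_mat k 1" "Y \<in> carrier_mat 1 1" "W = G * X + c * Y"
    using G by (auto simp: col_image_def)
  hence "W = (G * p + c * b) * (s * X + v * Y)" using G c by (simp add: splitting_simps)
  moreover have "s * X + v * Y \<in> carrier_mat (Suc k) 1" using XY by (intro carrier_matI) auto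
  ultimately show "W \<in> col_image (G * p + c * b)" by (auto simp: col_image_def)
qed

text \<open>For \<open>c = G * X\<close> the extension is \<open>G * (p + X * b)\<close>, and it
  restricts to \<open>G\<close>. Otherwise its column space is in bijection with the pairs of an
  element of \<open>col_image G\<close> and a scalar.\<close>

lemma rank_append:
  assumes G: "G \<in> carrier_mat l k" and c: "c \<in> carrier_mat l 1"
  shows "mat_rank l (G * p + c * b) = (if c \<in> col_image G then mat_rank l G else Suc (mat_rank l G))"
proof -
  let ?M = "G * p + c * b" and ?q = "card (UNIV :: 'a set)"
  have M: "?M \<in> carrier_mat l (Suc k)" using G c by (intro carrier_matI) auto
  have "mat_rank l ?M = mat_rank l G" if im: "c \<in> col_image G"
  proof (rule antisym)
    obtain X where X: "X \<in> carrier_mat k 1" "c = G * X" using im G by (auto simp: col_image_def)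
    have "?M = G * (p + X * b)" using X G by (simp add: splitting_simps)
    moreover have "p + X * b \<in> carrier_mat k (Suc k)" using X by (intro carrier_matI) auto
    ultimately show "mat_rank l ?M \<le> mat_rank l G" using mat_rank_mult_le_left[OF G] by simp
    show "mat_rank l G \<le> mat_rank l ?M"
      using mat_rank_mult_le_left[OF M carrier(1)] G c by (simp add: mult_col_right)
  qed
  moreover have "mat_rank l ?M = Suc (mat_rank l G)" if "c \<notin> col_image G"
  proof -
    have "?q ^ mat_rank l ?M = card (col_image ?M)" by (rule card_col_image[OF M, symmetric])
    also have "\<dots> = ?q ^ Suc (mat_rank l G)"
      unfolding col_image_append[OF G c] card_image[OF inj_on_col_image_sum[OF G c that]]
      by (simp add: card_cartesian_product card_col_image[OF G] card_carrier_mat)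
    finally have "?q ^ mat_rank l ?M = ?q ^ Suc (mat_rank l G)" .
    moreover have "1 < ?q" using card_field_ge_2[where 'a='a] by simp
    ultimately show ?thesis using power_inject_exp by blast
  qed
  ultimately show ?thesis by simp
qed

end

text \<open>All fibres of multiplication by \<open>G\<close> over its image are translates of the
  kernel. The factors on both sides avoid the exponent \<open>k - mat_rank n G\<close>.\<close>

lemma sum_col_image:
  fixes G :: "'a::{field,finite} mat" and f :: "'a mat \<Rightarrow> 'k::field"
  assumes G: "G \<in> carrier_mat n k"
  shows "of_nat (card (UNIV :: 'a set)) ^ mat_rank n G * (\<Sum>X\<in>carrier_mat k 1. f (G * X)) =
    of_nat (card (UNIV :: 'a set)) ^ k * (\<Sum>c\<in>col_image G. f c)"
proof -
  let ?q = "card (UNIV :: 'a set)"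
  have fibre: "card {X \<in> carrier_mat k 1. G * X = c} = card {X \<in> carrier_mat k 1. G * X = 0\<^sub>m n 1}"
    if c: "c \<in> col_image G" for c
  proof -
    obtain X0 where X0: "X0 \<in> carrier_mat k 1" "c = G * X0" using c G by (auto simp: col_image_def)
    have "bij_betw (\<lambda>X. X - X0) {X \<in> carrier_mat k 1. G * X = c} {X \<in> carrier_mat k 1. G * X = 0\<^sub>m n 1}"
      by (rule bij_betw_byWitness[where f' = "\<lambda>X. X + X0"])
        (use G X0 in \<open>auto simp: mult_minus_distrib_mat[OF G] mult_add_distrib_mat[OF G] intro!: eq_matI\<close>)
    thus ?thesis by (rule bij_betw_same_card)
  qed
  define z where "z = card {X \<in> carrier_mat k 1. G * X = 0\<^sub>m n 1}"
  have "?q ^ k = (\<Sum>c\<in>col_image G. card {X \<in> carrier_mat k 1. G * X = c})"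
    using sum.group[of "carrier_mat k 1" "col_image G" "(*) G" "\<lambda>_. 1::nat"] G
    by (simp add: col_image_def card_carrier_mat)
  also have "\<dots> = ?q ^ mat_rank n G * z" using fibre by (simp add: z_def card_col_image[OF G])
  finally have q: "(of_nat ?q ^ k :: 'k) = of_nat ?q ^ mat_rank n G * of_nat z"
    by (metis of_nat_mult of_nat_power)
  have "(\<Sum>X\<in>carrier_mat k 1. f (G * X)) =
      (\<Sum>c\<in>col_image G. \<Sum>X\<in>{X \<in> carrier_mat k 1. G * X = c}. f (G * X))"
    using G by (intro sum.group[symmetric]) (auto simp: col_image_def)
  also have "\<dots> = (\<Sum>c\<in>col_image G. of_nat z * f c)"
    by (rule sum.cong) (auto simp: fibre z_def simp del: One_nat_def)
  also have "\<dots> = of_nat z * (\<Sum>c\<in>col_image G. f c)" by (simp add: sum_distrib_left)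
  finally show ?thesis unfolding q by (simp add: mult_ac)
qed

subsection \<open>The function psi\<close>

text \<open>Compares \<open>A * B\<close> with \<open>B * A\<close>: their powers differ by outer
  factors and a shift of the exponent.\<close>

lemma pow_mat_mult_swap:
  fixes A B :: "'a::semiring_1 mat"
  assumes A: "A \<in> carrier_mat n k" and B: "B \<in> carrier_mat k n"
  shows "(A * B) ^\<^sub>m Suc i = A * (B * A) ^\<^sub>m i * B"
proof (induction i)
  case 0
  thus ?case using A B by simp
next
  case (Suc i)
  have P: "(B * A) ^\<^sub>m i \<in> carrier_mat k k" using A B by simp
  have "(A * B) ^\<^sub>m Suc (Suc i) = A * (B * A) ^\<^sub>m i * B * (A * B)" using Suc by simp
  also have "\<dots> = A * ((B * A) ^\<^sub>m i * (B * A)) * B"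
    using A B P by (simp add: mult_mat_assoc)
  finally show ?case by simp
qed

lemma pow_mat_commute:
  fixes m :: "'a::semiring_1 mat"
  assumes "m \<in> carrier_mat n n"
  shows "m ^\<^sub>m i * m = m * m ^\<^sub>m i"
  using assms by (induction i) (auto simp: mult_mat_assoc)

lemma semi_idempotent_pow:
  fixes m :: "'a::field mat"
  assumes m: "m \<in> carrier_mat n n" and N: "m * m ^\<^sub>m N = m ^\<^sub>m N" and "i \<ge> N"
  shows "m ^\<^sub>m i = m ^\<^sub>m N"
  using \<open>i \<ge> N\<close>
proof (induction i rule: dec_induct)
  case (step i)
  thus ?case using N m by (simp add: pow_mat_commute)
qed simp

text \<open>The powers are constant from \<open>N\<close> on, so the definite description has
  exactly one solution.\<close>

lemma stable_rank_eq:
  fixes m :: "'a::field mat"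
  assumes m: "m \<in> carrier_mat n n" and N: "m * m ^\<^sub>m N = m ^\<^sub>m N" and "i \<ge> N"
  shows "stable_rank n m = mat_rank n (m ^\<^sub>m i)"
  unfolding stable_rank_def
proof (rule the_equality)
  have *: "m ^\<^sub>m j = m ^\<^sub>m i" if "j \<ge> N" for j
    using semi_idempotent_pow[OF m N] that \<open>i \<ge> N\<close> by metis
  show "\<exists>M. \<forall>j\<ge>M. mat_rank n (m ^\<^sub>m j) = mat_rank n (m ^\<^sub>m i)"
    using * by (intro exI[of _ N]) auto
  fix t assume "\<exists>M. \<forall>j\<ge>M. mat_rank n (m ^\<^sub>m j) = t"
  then obtain M where "\<forall>j\<ge>M. mat_rank n (m ^\<^sub>m j) = t" by blast
  hence "mat_rank n (m ^\<^sub>m max M N) = t" by simp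
  thus "t = mat_rank n (m ^\<^sub>m i)" using *[of "max M N"] by simp
qed

text \<open>Powers of \<open>A * B\<close> sandwich those of \<open>B * A\<close>, so
  \<open>A * B\<close> becomes stationary at most one exponent later.\<close>

lemma semi_idempotent_mult_swap:
  fixes A B :: "'a::field mat"
  assumes A: "A \<in> carrier_mat n k" and B: "B \<in> carrier_mat k n"
    and N: "(B * A) * (B * A) ^\<^sub>m N = (B * A) ^\<^sub>m N"
  shows "(A * B) * (A * B) ^\<^sub>m Suc N = (A * B) ^\<^sub>m Suc N"
proof -
  have P: "(B * A) ^\<^sub>m N \<in> carrier_mat k k" using A B by simp
  have "(A * B) * (A * B) ^\<^sub>m Suc N = A * ((B * A) * (B * A) ^\<^sub>m N) * B"
    unfolding pow_mat_mult_swap[OF A B] using A B P by (simp add: mult_mat_assoc)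
  also have "\<dots> = (A * B) ^\<^sub>m Suc N" unfolding N pow_mat_mult_swap[OF A B] ..
  finally show ?thesis .
qed

lemma rank_pow_mult_swap_le:
  fixes A B :: "'a::{field,finite} mat"
  assumes A: "A \<in> carrier_mat n k" and B: "B \<in> carrier_mat k n"
  shows "mat_rank n ((A * B) ^\<^sub>m Suc i) \<le> mat_rank k ((B * A) ^\<^sub>m i)"
proof -
  have P: "(B * A) ^\<^sub>m i \<in> carrier_mat k k" using A B by simp
  have "mat_rank n (A * (B * A) ^\<^sub>m i * B) \<le> mat_rank n (A * (B * A) ^\<^sub>m i)"
    by (rule mat_rank_mult_le_left) (use A B P in auto)
  also have "\<dots> \<le> mat_rank k ((B * A) ^\<^sub>m i)"
    by (rule mat_rank_mult_le_right) (use A B P in auto)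
  finally show ?thesis unfolding pow_mat_mult_swap[OF A B] .
qed

text \<open>\<open>dim_row\<close> supplies the size, so that one function serves square matrices of
  every dimension and can be compared on \<open>A * B\<close> and \<open>B * A\<close>.\<close>

definition psi :: "'a::{field,finite} mat \<Rightarrow> 'k::field" where
  "psi m = (if semi_idempotent m then mu (card (UNIV :: 'a set)) (stable_rank (dim_row m) m) else 0)"

text \<open>Semi-idempotency passes between the two products, and sandwiching bounds each stable
  rank by the other.\<close>

lemma psi_mult_swap:
  fixes A B :: "'a::{field,finite} mat"
  assumes A: "A \<in> carrier_mat n k" and B: "B \<in> carrier_mat k n"
  shows "(psi (A * B) :: 'k::field) = psi (B * A)"
proof (cases "semi_idempotent (A * B)")
  case True
  then obtain N where N: "(A * B) * (A * B) ^\<^sub>m N = (A * B) ^\<^sub>m N"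
    unfolding semi_idempotent_def by blast
  note N' = semi_idempotent_mult_swap[OF B A N]
  have AB: "A * B \<in> carrier_mat n n" "B * A \<in> carrier_mat k k" using A B by auto
  \<comment> \<open>\<open>B * A\<close> is only known to be stationary from \<open>Suc N\<close>
    on, so it is compared with the power \<open>Suc (Suc N)\<close> of \<open>A * B\<close>.\<close>
  have "stable_rank n (A * B) \<le> stable_rank k (B * A)"
    using rank_pow_mult_swap_le[OF A B, of "Suc N"] stable_rank_eq[OF AB(1) N, of "Suc (Suc N)"]
      stable_rank_eq[OF AB(2) N', of "Suc N"] by simp
  moreover have "stable_rank k (B * A) \<le> stable_rank n (A * B)"
    using rank_pow_mult_swap_le[OF B A, of "Suc N"] stable_rank_eq[OF AB(1) N, of "Suc N"]
      stable_rank_eq[OF AB(2) N', of "Suc (Suc N)"] by simp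
  moreover have "semi_idempotent (B * A)" using N' unfolding semi_idempotent_def by blast
  ultimately show ?thesis using True A B unfolding psi_def by auto
next
  case False
  hence "\<not> semi_idempotent (B * A)"
    using semi_idempotent_mult_swap[OF A B] unfolding semi_idempotent_def by blast
  with False show ?thesis by (simp add: psi_def)
qed

lemma mat_rank_one: "mat_rank n (1\<^sub>m n :: 'a::{field,finite} mat) = n"
  by (subst mat_rank_inj[of _ n n]) (auto simp: inj_on_def)

lemma psi_one: "psi (1\<^sub>m n :: 'a::{field,finite} mat) = mu (card (UNIV :: 'a set)) n"
proof -
  have "(1\<^sub>m n :: 'a mat) * 1\<^sub>m n ^\<^sub>m 0 = 1\<^sub>m n ^\<^sub>m 0" by simp
  thus ?thesis using stable_rank_eq[of "1\<^sub>m n :: 'a mat" n 0 0]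
    by (auto simp: psi_def semi_idempotent_def mat_rank_one)
qed

lemma mat_eq_on_columns:
  fixes A B :: "'a::semiring_1 mat"
  assumes "A \<in> carrier_mat n k" "B \<in> carrier_mat n k"
    and "\<And>X. X \<in> carrier_mat k 1 \<Longrightarrow> A * X = B * X"
  shows "A = B"
proof (rule eq_matI)
  fix i j assume "i < dim_row B" "j < dim_col B"
  hence ij: "i < n" "j < k" using assms by auto
  define X :: "'a mat" where "X = mat k 1 (\<lambda>(a, _). if a = j then 1 else 0)"
  have "(M * X) $$ (i, 0) = M $$ (i, j)" if "M \<in> carrier_mat n k" for M
    using that ij by (simp add: X_def scalar_prod_def if_distrib[of "\<lambda>x. _ * x"] cong: if_cong)
  moreover have "A * X = B * X" by (rule assms) (simp add: X_def)
  ultimately show "A $$ (i, j) = B $$ (i, j)" using assms(1,2) by metis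
qed (use assms in auto)

text \<open>Powers of an injective \<open>m\<close> are injective, so \<open>m ^\<^sub>m N\<close>
  cancels from \<open>m ^\<^sub>m N * (m * X) = m ^\<^sub>m N * X\<close>.\<close>

lemma semi_idempotent_inj:
  fixes m :: "'a::field mat"
  assumes m: "m \<in> carrier_mat n n" and inj: "inj_on ((*) m) (carrier_mat n 1)"
    and semi: "semi_idempotent m"
  shows "m = 1\<^sub>m n"
proof -
  obtain N where N: "m * m ^\<^sub>m N = m ^\<^sub>m N" using semi unfolding semi_idempotent_def by blast
  have "Y = X" if "m ^\<^sub>m i * Y = m ^\<^sub>m i * X" "Y \<in> carrier_mat n 1" "X \<in> carrier_mat n 1" for i X Y
    using that
  proof (induction i arbitrary: X Y)
    case (Suc i)
    have "m ^\<^sub>m i * (m * Y) = m ^\<^sub>m i * (m * X)"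
      using Suc.prems m by (simp add: mult_mat_assoc)
    hence "m * Y = m * X" using Suc m by (metis mult_carrier_mat)
    thus ?case using inj Suc.prems by (simp add: inj_on_def)
  qed (use m in simp)
  moreover have "m ^\<^sub>m N * (m * X) = m ^\<^sub>m N * X" if "X \<in> carrier_mat n 1" for X
    using N m that by (metis assoc_mult_mat pow_carrier_mat pow_mat_commute)
  ultimately have "m * X = X" if "X \<in> carrier_mat n 1" for X
    using that m by (metis mult_carrier_mat)
  thus ?thesis by (intro mat_eq_on_columns[OF m]) auto
qed

lemma psi_inj:
  fixes m :: "'a::{field,finite} mat"
  assumes "m \<in> carrier_mat n n" "inj_on ((*) m) (carrier_mat n 1)"
  shows "(psi m :: 'k::field) = (if m = 1\<^sub>m n then mu (card (UNIV :: 'a set)) n else 0)"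
  using semi_idempotent_inj[OF assms] by (auto simp: psi_one) (auto simp: psi_def)

text \<open>This recursion makes the contribution of the identity cancel against the extensions of
  \<open>s\<close> of the same rank.\<close>

lemma mu_Suc: "(mu q (Suc k) :: 'k::field) = - (of_nat q ^ k * mu q k)"
proof -
  have "Suc k choose 2 = k + (k choose 2)" by (simp add: numeral_2_eq_2)
  thus ?thesis by (simp add: mu_def power_add)
qed

section \<open>Vanishing of \<open>psi\<close> sums over rank-one families\<close>

context finite_splitting
begin

text \<open>Swapping the factors of \<open>G * (p + x * b)\<close> gives
  \<open>p * G + x * (b * G)\<close>, a family one dimension lower with row \<open>b * G\<close>.
  Its vanishing is an assumption so that the lemma can serve inside the induction as well as after
  it.\<close>

lemma sum_psi_image:
  assumes G: "G \<in> carrier_mat (Suc k) k"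
    and vanish: "b * G \<noteq> 0\<^sub>m 1 k \<Longrightarrow> (\<Sum>x\<in>carrier_mat k 1. psi (p * G + x * (b * G))) = (0 :: 'k::field)"
  shows "(\<Sum>x\<in>carrier_mat k 1. psi (G * p + (G * x) * b)) =
    (if b * G = 0\<^sub>m 1 k then of_nat (card (UNIV :: 'a set)) ^ k * psi (p * G) else (0 :: 'k))"
proof -
  have "(psi (G * p + (G * x) * b) :: 'k) = psi (p * G + x * (b * G))" if "x \<in> carrier_mat k 1" for x
  proof -
    have "G * p + (G * x) * b = G * (p + x * b)" "p * G + x * (b * G) = (p + x * b) * G"
      using that G by (simp_all add: splitting_simps)
    moreover have "p + x * b \<in> carrier_mat k (Suc k)" using that by (intro carrier_matI) auto
    ultimately show ?thesis using psi_mult_swap[OF G] by metis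
  qed
  hence "(\<Sum>x\<in>carrier_mat k 1. psi (G * p + (G * x) * b) :: 'k) =
      (\<Sum>x\<in>carrier_mat k 1. psi (p * G + x * (b * G)))" by simp
  also have "\<dots> = (if b * G = 0\<^sub>m 1 k then of_nat (card (UNIV :: 'a set)) ^ k * psi (p * G) else 0)"
  proof (cases "b * G = 0\<^sub>m 1 k")
    case True
    have "(\<Sum>x\<in>carrier_mat k 1. psi (p * G + x * (b * G)) :: 'k) = (\<Sum>x\<in>(carrier_mat k 1 :: 'a mat set). psi (p * G))"
      unfolding True by (rule sum.cong) (use G in \<open>auto simp: splitting_simps\<close>)
    thus ?thesis using True by (simp add: card_carrier_mat)
  qed (use vanish in simp)
  finally show ?thesis .
qed

text \<open>An injective semi-idempotent matrix is the identity, whose restrictions to the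
  hyperplane and the line are \<open>s\<close> and \<open>v\<close>.\<close>

lemma psi_full_rank:
  assumes G: "G \<in> carrier_mat (Suc k) k" and c: "c \<in> carrier_mat (Suc k) 1"
    and rank: "mat_rank (Suc k) (G * p + c * b) = Suc k"
  shows "(psi (G * p + c * b) :: 'k::field) =
    (if G = s \<and> c = v then mu (card (UNIV :: 'a set)) (Suc k) else 0)"
proof -
  have M: "G * p + c * b \<in> carrier_mat (Suc k) (Suc k)" using G c by (intro carrier_matI) auto
  have "G * p + c * b = 1\<^sub>m (Suc k) \<longleftrightarrow> G = s \<and> c = v"
  proof
    assume eq: "G * p + c * b = 1\<^sub>m (Suc k)"
    show "G = s \<and> c = v"
      using mult_col_right[of G c] G c carrier unfolding eq by simp
  qed (simp add: sum)
  thus ?thesis using psi_inj[OF M] rank mat_rank_inj[OF M] by auto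
qed

lemma v_notin_image: "v \<notin> col_image s"
proof
  assume "v \<in> col_image s"
  then obtain X where X: "X \<in> carrier_mat k 1" "v = s * X" by (auto simp: col_image_def)
  hence "b * v = 0\<^sub>m 1 1" by (simp add: left_cancel)
  hence "(1\<^sub>m 1 :: 'a mat) $$ (0, 0) = 0\<^sub>m 1 1 $$ (0, 0)" unfolding bv by simp
  thus False by simp
qed

lemma sum_psi_outside_image:
  assumes G: "G \<in> carrier_mat (Suc k) k" and rank: "mat_rank (Suc k) G = k"
  shows "(\<Sum>c\<in>carrier_mat (Suc k) 1 - col_image G. psi (G * p + c * b)) =
    (if G = s then mu (card (UNIV :: 'a set)) (Suc k) else (0 :: 'k::field))"
proof -
  have "(\<Sum>c\<in>carrier_mat (Suc k) 1 - col_image G. psi (G * p + c * b) :: 'k) =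
      (\<Sum>c\<in>carrier_mat (Suc k) 1 - col_image G. if c = v then if G = s then mu (card (UNIV :: 'a set)) (Suc k) else 0 else 0)"
  proof (rule sum.cong)
    fix c assume c: "c \<in> carrier_mat (Suc k) 1 - col_image G"
    hence "mat_rank (Suc k) (G * p + c * b) = Suc k" using rank_append[OF G, of c] rank by simp
    thus "(psi (G * p + c * b) :: 'k) = (if c = v then if G = s then mu (card (UNIV :: 'a set)) (Suc k) else 0 else 0)"
      using psi_full_rank[OF G, of c] c by auto
  qed simp
  also have "\<dots> = (if G = s then mu (card (UNIV :: 'a set)) (Suc k) else 0)"
    using v_notin_image carrier(4) by (auto simp: sum.delta)
  finally show ?thesis .
qed

lemma sum_carrier_split:
  fixes G :: "'a mat"
  assumes "G \<in> carrier_mat l k"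
  shows "(\<Sum>c\<in>carrier_mat l 1. f c) = (\<Sum>c\<in>col_image G. f c) + (\<Sum>c\<in>carrier_mat l 1 - col_image G. f c)"
  using sum.subset_diff[OF col_image_carrier[OF assms], of f] by (simp add: add.commute del: One_nat_def)

text \<open>\<open>b * G = 0\<close> says that the columns of \<open>G\<close> lie in the kernel of
  \<open>b\<close>, on which \<open>s * p\<close> is the identity.\<close>

lemma eq_s_mult_p: "dim_row G = Suc k \<Longrightarrow> b * G = 0\<^sub>m 1 (dim_col G) \<Longrightarrow> s * (p * G) = G"
  using decompose_left[of G] by (simp add: splitting_simps)

text \<open>Inside the image of \<open>G\<close> a contribution remains only if
  \<open>b * G = 0\<close>; then \<open>p * G\<close> is invertible and counts only for
  \<open>G = s\<close>. The resulting \<open>q ^ k * mu q k\<close> cancels the identity, the sole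
  contribution from outside.\<close>

lemma sum_psi_full_rank:
  assumes G: "G \<in> carrier_mat (Suc k) k" and rank: "mat_rank (Suc k) G = k"
    and vanish: "b * G \<noteq> 0\<^sub>m 1 k \<Longrightarrow> (\<Sum>x\<in>carrier_mat k 1. psi (p * G + x * (b * G))) = (0 :: 'k::field)"
  shows "(\<Sum>c\<in>carrier_mat (Suc k) 1. psi (G * p + c * b)) = (0 :: 'k)"
proof -
  let ?q = "card (UNIV :: 'a set)"
  have inj: "inj_on ((*) G) (carrier_mat k 1)" using rank mat_rank_inj[OF G] by simp
  have "(\<Sum>c\<in>col_image G. psi (G * p + c * b) :: 'k) = (\<Sum>x\<in>carrier_mat k 1. psi (G * p + (G * x) * b))"
    unfolding col_image_def using G inj by (simp add: sum.reindex)
  also have "\<dots> = (if b * G = 0\<^sub>m 1 k then of_nat ?q ^ k * psi (p * G) else 0)"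
    by (rule sum_psi_image[OF G vanish])
  also have "\<dots> = (if G = s then - mu ?q (Suc k) else 0)"
  proof (cases "b * G = 0\<^sub>m 1 k")
    case True
    hence sp: "s * (p * G) = G" using eq_s_mult_p[of G] G by simp
    have P: "p * G \<in> carrier_mat k k" using G by (intro carrier_matI) auto
    have "k \<le> mat_rank k (p * G)" using mat_rank_mult_le_right[OF carrier(1) P] unfolding sp rank .
    hence "mat_rank k (p * G) = k" using mat_rank_le_cols[OF P] by simp
    hence "(psi (p * G) :: 'k) = (if p * G = 1\<^sub>m k then mu ?q k else 0)"
      using psi_inj[OF P] mat_rank_inj[OF P] by simp
    moreover have "p * G = 1\<^sub>m k \<longleftrightarrow> G = s"
      using sp carrier ps by (metis right_mult_one_mat)
    ultimately show ?thesis using True by (simp add: mu_Suc)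
  next
    case False
    hence "G \<noteq> s" using bs by metis
    thus ?thesis using False by simp
  qed
  finally show ?thesis
    unfolding sum_carrier_split[OF G, of "\<lambda>c. psi (G * p + c * b)"] sum_psi_outside_image[OF G rank] by simp
qed

lemma b_nonzero: "b \<noteq> 0\<^sub>m 1 (Suc k)"
proof
  assume "b = 0\<^sub>m 1 (Suc k)"
  hence "1\<^sub>m 1 = (0\<^sub>m 1 1 :: 'a mat)" using bv by (simp add: mult_zero_mat_dim)
  hence "(1\<^sub>m 1 :: 'a mat) $$ (0, 0) = 0\<^sub>m 1 1 $$ (0, 0)" by simp
  thus False by simp
qed

text \<open>All extensions kill a common line, so each factors as \<open>(M * s2) * p2\<close>
  through the quotient by it. Swapping the factors yields a family one dimension lower with the
  nonzero row \<open>b * s2\<close>.\<close>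

lemma sum_psi_deficient:
  assumes G: "G \<in> carrier_mat (Suc k) k" and rank: "mat_rank (Suc k) G < k"
    and IH: "\<And>(M :: 'a mat) b'. M \<in> carrier_mat k k \<Longrightarrow> b' \<in> carrier_mat 1 k \<Longrightarrow> b' \<noteq> 0\<^sub>m 1 k \<Longrightarrow>
      (\<Sum>x\<in>carrier_mat k 1. psi (M + x * b')) = (0 :: 'k::field)"
  shows "(\<Sum>c\<in>carrier_mat (Suc k) 1. psi (G * p + c * b)) = (0 :: 'k)"
proof -
  have "\<not> inj_on ((*) G) (carrier_mat k 1)" using rank mat_rank_inj[OF G] by simp
  then obtain x y where xy: "x \<in> carrier_mat k 1" "y \<in> carrier_mat k 1" "G * x = G * y" "x \<noteq> y"
    by (auto simp: inj_on_def)
  define u' where "u' = x - y"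
  have u': "u' \<in> carrier_mat k 1" using xy by (auto simp: u'_def)
  have Gu': "G * u' = 0\<^sub>m (Suc k) 1"
    unfolding u'_def mult_minus_distrib_mat[OF G xy(1,2)] using xy G by (auto intro!: eq_matI)
  have "u' \<noteq> 0\<^sub>m k 1"
  proof
    assume *: "u' = 0\<^sub>m k 1"
    have "x $$ (i, j) = y $$ (i, j)" if "i < k" "j < 1" for i j
      using arg_cong[OF *, of "\<lambda>A. A $$ (i, j)"] that xy by (simp add: u'_def)
    hence "x = y" using xy by (intro eq_matI) auto
    thus False using xy by simp
  qed
  \<comment> \<open>\<open>u\<close> lies in the hyperplane and is killed by \<open>G * p\<close>,
    hence by every member of the family, whatever \<open>c\<close> is.\<close>
  define u where "u = s * u'"
  have u: "u \<in> carrier_mat (Suc k) 1" using u' by (auto simp: u_def intro: carrier_matI)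
  have pu: "p * u = u'" and bu: "b * u = 0\<^sub>m 1 1" using u' by (auto simp: u_def left_cancel)
  have "u \<noteq> 0\<^sub>m (Suc k) 1" using pu \<open>u' \<noteq> 0\<^sub>m k 1\<close> by (auto simp: splitting_simps)
  then obtain s2 p2 b2 where "splitting k s2 p2 b2 u" using ex_splitting_col[OF u] by metis
  then interpret S2: splitting k s2 p2 b2 u .
  have b_s2: "b * s2 \<in> carrier_mat 1 k" by (intro carrier_matI) auto
  have b_eq: "b * s2 * p2 = b"
    using S2.decompose_right[of b] unfolding bu by (simp add: mult_zero_mat_dim add_zero_mat_dim)
  have b_s2_nz: "b * s2 \<noteq> 0\<^sub>m 1 k" using b_eq b_nonzero by (auto simp: mult_zero_mat_dim)
  have step: "(psi (G * p + c * b) :: 'k) = psi (p2 * G * p * s2 + p2 * c * (b * s2))"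
    if c: "c \<in> carrier_mat (Suc k) 1" for c
  proof -
    define M where "M = G * p + c * b"
    have M: "M \<in> carrier_mat (Suc k) (Suc k)" unfolding M_def using G c by (intro carrier_matI) auto
    have Mu: "M * u = 0\<^sub>m (Suc k) 1" unfolding M_def using G c u by (simp add: splitting_simps pu Gu' bu)
    have "M * s2 * p2 = M"
      using S2.decompose_right[of M] M unfolding Mu by (simp add: mult_zero_mat_dim add_zero_mat_dim)
    moreover have "(psi (M * s2 * p2) :: 'k) = psi (p2 * (M * s2))"
      by (rule psi_mult_swap) (use M S2.carrier in auto)
    ultimately have "(psi M :: 'k) = psi (p2 * (M * s2))" by simp
    also have "p2 * (M * s2) = p2 * G * p * s2 + p2 * c * (b * s2)"
      unfolding M_def using G c by (simp add: splitting_simps)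
    finally show ?thesis unfolding M_def .
  qed
  have "(\<Sum>c\<in>carrier_mat (Suc k) 1. psi (G * p + c * b) :: 'k) =
      (\<Sum>c\<in>carrier_mat (Suc k) 1. psi (p2 * G * p * s2 + p2 * c * (b * s2)))"
    by (rule sum.cong) (auto simp: step)
  \<comment> \<open>For \<open>c = s2 * X + u * Y\<close> the summand depends only on
    \<open>X = p2 * c\<close>, while \<open>Y\<close> is free.\<close>
  also have "\<dots> = (\<Sum>X\<in>carrier_mat k 1. \<Sum>Y\<in>(carrier_mat 1 1 :: 'a mat set). psi (p2 * G * p * s2 + X * (b * s2)))"
  proof -
    have "p2 * (s2 * X + u * Y) = X" if "X \<in> carrier_mat k 1" "Y \<in> carrier_mat 1 1" for X Y
      using that by (simp add: S2.splitting_simps)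
    thus ?thesis unfolding S2.sum_decompose_left by (intro sum.cong refl) simp
  qed
  also have "\<dots> = (\<Sum>Y\<in>(carrier_mat 1 1 :: 'a mat set). \<Sum>X\<in>carrier_mat k 1. psi (p2 * G * p * s2 + X * (b * s2)))"
    by (rule sum.swap)
  also have "\<dots> = 0"
  proof -
    have "p2 * G * p * s2 \<in> carrier_mat k k" by (intro carrier_matI) auto
    from IH[OF this b_s2 b_s2_nz] show ?thesis by simp
  qed
  finally show ?thesis .
qed

end

text \<open>Induction on the dimension, splitting along \<open>b\<close> and distinguishing whether
  the restriction \<open>G\<close> of \<open>M\<close> to its kernel is injective.\<close>

lemma sum_psi_rank_one_perturbation:
  fixes M b :: "'a::{field,finite} mat"
  assumes "M \<in> carrier_mat n n" "b \<in> carrier_mat 1 n" "b \<noteq> 0\<^sub>m 1 n"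
  shows "(\<Sum>c\<in>carrier_mat n 1. psi (M + c * b)) = (0 :: 'k::field)"
  using assms
proof (induction n arbitrary: M b)
  case 0
  thus ?case by (metis carrier_matD(1,2) eq_matI index_zero_mat(2,3) less_nat_zero_code)
next
  case (Suc k)
  obtain s p v where "splitting k s p b v" using ex_splitting_row[OF Suc.prems(2,3)] .
  then interpret finite_splitting k s p b v by (rule finite_splitting.intro)
  define G where "G = M * s"
  have G: "G \<in> carrier_mat (Suc k) k" using Suc.prems by (auto simp: G_def intro: carrier_matI)
  have Mv: "M * v \<in> carrier_mat (Suc k) 1" using Suc.prems by (auto intro: carrier_matI)
  have "(\<Sum>c\<in>carrier_mat (Suc k) 1. psi (M + c * b) :: 'k) =
      (\<Sum>c\<in>carrier_mat (Suc k) 1. psi (G * p + c * b))"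
  \<comment> \<open>Translating \<open>c\<close> by \<open>M * v\<close> absorbs the value of
    \<open>M\<close> on the line, so only the restriction to the hyperplane matters.\<close>
  proof (rule sum.reindex_bij_witness[where i = "\<lambda>c. c - M * v" and j = "\<lambda>c. c + M * v"])
    fix c :: "'a mat" assume c: "c \<in> carrier_mat (Suc k) 1"
    have "G * p + (c + M * v) * b = (G * p + M * v * b) + c * b"
    proof -
      have "(c + M * v) * b = c * b + M * v * b"
        by (rule mult_mat_distrib_right) (use c Mv in auto)
      thus ?thesis using c Mv G by (auto intro!: eq_matI simp del: index_mult_mat(1))
    qed
    thus "psi (G * p + (c + M * v) * b) = (psi (M + c * b) :: 'k)"
      unfolding G_def using decompose_right[of M] Suc.prems by simp
  next
    fix c :: "'a mat" assume c: "c \<in> carrier_mat (Suc k) 1"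
    define w where "w = M * v"
    have w: "w \<in> carrier_mat (Suc k) 1" using Mv by (simp add: w_def)
    have "c + w - w = c" "c - w + w = c" using c w by (auto intro!: eq_matI)
    thus "c + M * v - M * v = c" "c - M * v + M * v = c" by (simp_all add: w_def)
    show "c + M * v \<in> carrier_mat (Suc k) 1" using c Mv by simp
    show "c - M * v \<in> carrier_mat (Suc k) 1" using Mv by (intro carrier_matI) auto
  qed
  also have "\<dots> = 0"
  proof (cases "mat_rank (Suc k) G = k")
    case True
    show ?thesis
      by (rule sum_psi_full_rank[OF G True], rule Suc.IH) (use G in \<open>auto intro: carrier_matI\<close>)
  next
    case False
    hence "mat_rank (Suc k) G < k" using mat_rank_le_cols[OF G] by simp
    thus ?thesis by (rule sum_psi_deficient[OF G]) (rule Suc.IH)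
  qed
  finally show ?case .
qed

subsection \<open>Gaussian binomials\<close>

definition qint :: "nat \<Rightarrow> nat \<Rightarrow> nat" where
  "qint q i = (q ^ i - 1) div (q - 1)"

lemma qfact_Suc: "qfact q (Suc a) = qfact q a * qint q (Suc a)"
  by (simp add: qfact_def qint_def)

lemma qfact_0: "qfact q 0 = 1"
  by (simp add: qfact_def)

text \<open>The division is exact; passing to reals avoids truncated subtraction.\<close>

lemma qint_mult:
  assumes "q \<ge> 2"
  shows "real (qint q i) * (real q - 1) = real q ^ i - 1"
proof -
  have "q - 1 dvd q ^ i - 1"
  proof -
    have "int q - 1 dvd int q ^ i - 1" using power_diff_1_eq[of "int q" i] by simp
    hence "int (q - 1) dvd int (q ^ i - 1)" using assms by (simp add: of_nat_diff)
    thus ?thesis by simp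
  qed
  hence "qint q i * (q - 1) = q ^ i - 1" by (simp add: qint_def)
  hence "real (qint q i) * real (q - 1) = real (q ^ i - 1)"
    by (metis of_nat_mult)
  thus ?thesis using assms by (simp add: of_nat_diff)
qed

lemma qfact_pos: "q \<ge> 2 \<Longrightarrow> qfact q a > 0"
proof (induction a)
  case (Suc a)
  have "real q ^ Suc a > 1" using Suc.prems by (intro one_less_power) auto
  hence "qint q (Suc a) \<noteq> 0" using qint_mult[OF Suc.prems, of "Suc a"] by (intro notI) simp
  thus ?case unfolding qfact_Suc using Suc by simp
qed (simp add: qfact_0)

lemma qint_add:
  assumes q: "q \<ge> 2"
  shows "qint q (a + b) = qint q a + q ^ a * qint q b"
proof -
  have "real (qint q (a + b)) * (real q - 1) = (real (qint q a) + real q ^ a * real (qint q b)) * (real q - 1)"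
    unfolding distrib_right mult.assoc qint_mult[OF q] by (simp add: algebra_simps power_add)
  hence "real (qint q (a + b)) = real (qint q a + q ^ a * qint q b)" using q by simp
  thus ?thesis by (simp only: of_nat_eq_iff)
qed

text \<open>Pascal's rule cleared of denominators, obtained by splitting the last q-integer.\<close>

lemma qfact_add:
  assumes q: "q \<ge> 2"
  shows "qfact q (Suc a + Suc b) =
    qfact q (a + Suc b) * qint q (Suc a) + q ^ Suc a * (qfact q (Suc a + b) * qint q (Suc b))"
proof -
  have "qfact q (Suc a + Suc b) = qfact q (Suc (a + b)) * qint q (Suc a + Suc b)"
    using qfact_Suc[of q "Suc (a + b)"] by simp
  thus ?thesis unfolding qint_add[OF q] by (simp add: distrib_left mult.left_commute)
qed

text \<open>By induction the divisor divides both summands of \<open>qfact_add\<close>. This makes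
  the division in \<open>qbinom\<close> exact.\<close>

lemma qfact_dvd:
  assumes q: "q \<ge> 2"
  shows "qfact q a * qfact q b dvd qfact q (a + b)"
proof (induction "a + b" arbitrary: a b)
  case (Suc n)
  show ?case
  proof (cases "a = 0 \<or> b = 0")
    case True
    thus ?thesis by (auto simp: qfact_0)
  next
    case False
    then obtain a' b' where ab: "a = Suc a'" "b = Suc b'" by (metis not0_implies_Suc)
    have "qfact q a' * qfact q b dvd qfact q (a' + b)" "qfact q a * qfact q b' dvd qfact q (a + b')"
      using Suc(1)[of a' b] Suc(1)[of a b'] Suc(2) ab by auto
    hence "qfact q a' * qfact q b * qint q a dvd qfact q (a' + b) * qint q a"
      "qfact q a * qfact q b' * qint q b dvd qfact q (a + b') * qint q b"
      by (auto intro: mult_dvd_mono)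
    moreover have "qfact q a' * qfact q b * qint q a = qfact q a * qfact q b"
      "qfact q a * qfact q b' * qint q b = qfact q a * qfact q b"
      unfolding ab qfact_Suc by (simp_all add: mult_ac)
    ultimately have "qfact q a * qfact q b dvd
        qfact q (a' + b) * qint q a + q ^ a * (qfact q (a + b') * qint q b)"
      by (simp add: dvd_add)
    thus ?thesis unfolding ab qfact_add[OF q] .
  qed
qed (simp add: qfact_0)

lemma qbinom_mult:
  assumes "q \<ge> 2"
  shows "qbinom q (a + b) b * (qfact q a * qfact q b) = qfact q (a + b)"
  using qfact_dvd[OF assms, of a b] unfolding qbinom_def by (simp add: mult.commute)

lemma qbinom_refl: "q \<ge> 2 \<Longrightarrow> qbinom q a a = 1"
  using qfact_pos[of q a] by (simp add: qbinom_def qfact_0)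

lemma qbinom_0: "q \<ge> 2 \<Longrightarrow> qbinom q a 0 = 1"
  using qfact_pos[of q a] by (simp add: qbinom_def qfact_0)

text \<open>Multiplying by \<open>?F\<close> reduces this to \<open>qfact_add\<close>. For
  \<open>b < a\<close> both lower indices on the right stay within range.\<close>

lemma qbinom_pascal:
  assumes q: "q \<ge> 2" and "b < a"
  shows "qbinom q (Suc a) (Suc b) = qbinom q a b + q ^ Suc b * qbinom q a (Suc b)"
proof -
  obtain d where a: "a = Suc (b + d)" using \<open>b < a\<close> less_imp_Suc_add by blast
  let ?F = "qfact q (Suc d) * qfact q (Suc b)"
  have "qbinom q (Suc a) (Suc b) * ?F = qfact q (Suc b + Suc d)"
    using qbinom_mult[OF q, of "Suc d" "Suc b"] by (simp add: a add.commute)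
  also have "\<dots> = qfact q a * qint q (Suc b) + q ^ Suc b * (qfact q a * qint q (Suc d))"
    unfolding qfact_add[OF q] by (simp add: a)
  also have "qfact q a * qint q (Suc b) = qbinom q a b * ?F"
    using qbinom_mult[OF q, of "Suc d" b] unfolding qfact_Suc[of q b] by (simp add: a add.commute mult_ac)
  also have "qfact q a * qint q (Suc d) = qbinom q a (Suc b) * ?F"
    using qbinom_mult[OF q, of d "Suc b"] unfolding qfact_Suc[of q d] by (simp add: a add.commute mult_ac)
  finally have "qbinom q (Suc a) (Suc b) * ?F = (qbinom q a b + q ^ Suc b * qbinom q a (Suc b)) * ?F"
    by (simp add: distrib_right mult.assoc)
  moreover have "?F > 0" using qfact_pos[OF q] by simp
  ultimately show ?thesis by simp
qed

subsection \<open>Sums weighted by rank\<close>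

text \<open>The q-binomial factor of \<open>eta\<close>. The cut-off is explicit because for
  \<open>t > r\<close> truncated subtraction would give a lower index 0 and the value 1.\<close>

definition rank_weight :: "nat \<Rightarrow> nat \<Rightarrow> nat \<Rightarrow> nat \<Rightarrow> 'k::field" where
  "rank_weight q n r t = (if t \<le> r then of_nat (qbinom q (n - 1 - t) (r - t)) else 0)"

text \<open>Pascal's rule leaves \<open>q ^ (r - t)\<close> times the weight for dimension
  \<open>k\<close>; the prefactor makes the power independent of \<open>t\<close>.\<close>

lemma rank_weight_diff:
  assumes q: "q \<ge> 2" and "r < k"
  shows "of_nat q ^ t * (rank_weight q (Suc k) r t - rank_weight q (Suc k) r (Suc t)) =
    (of_nat q ^ r * rank_weight q k r t :: 'k::field)"
proof (cases "t < r")
  case True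
  define a b where "a = k - 1 - t" and "b = r - 1 - t"
  have ab: "k - t = Suc a" "r - t = Suc b" "k - Suc t = a" "r - Suc t = b" "k - 1 - t = a" "b < a"
    "r = t + Suc b"
    using True \<open>r < k\<close> by (auto simp: a_def b_def)
  have "rank_weight q (Suc k) r t = (of_nat (qbinom q (Suc a) (Suc b)) :: 'k)"
    "rank_weight q (Suc k) r (Suc t) = (of_nat (qbinom q a b) :: 'k)"
    "rank_weight q k r t = (of_nat (qbinom q a (Suc b)) :: 'k)"
    using True ab(1-6) by (simp_all add: rank_weight_def)
  thus ?thesis unfolding qbinom_pascal[OF q \<open>b < a\<close>] ab(7)
    by (simp add: power_add algebra_simps)
next
  case False
  thus ?thesis using q by (cases "t = r") (auto simp: rank_weight_def qbinom_0)
qed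

context finite_splitting
begin

text \<open>Summing over \<open>c = G * x\<close> counts each column with the size of a fibre;
  \<open>q\<close> being nonzero in the field allows cancelling \<open>q ^ k\<close>.\<close>

lemma sum_psi_col_image:
  assumes q: "of_nat (card (UNIV :: 'a set)) \<noteq> (0 :: 'k::field)" and G: "G \<in> carrier_mat (Suc k) k"
  shows "(\<Sum>c\<in>col_image G. psi (G * p + c * b)) = (if b * G = 0\<^sub>m 1 k
    then of_nat (card (UNIV :: 'a set)) ^ mat_rank (Suc k) G * psi (p * G) else (0 :: 'k))"
proof -
  let ?q = "of_nat (card (UNIV :: 'a set)) :: 'k"
  have "?q ^ k * (\<Sum>c\<in>col_image G. psi (G * p + c * b)) =
      ?q ^ mat_rank (Suc k) G * (\<Sum>x\<in>carrier_mat k 1. psi (G * p + (G * x) * b))"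
    by (rule sum_col_image[OF G, symmetric])
  also have "(\<Sum>x\<in>carrier_mat k 1. psi (G * p + (G * x) * b) :: 'k) =
      (if b * G = 0\<^sub>m 1 k then ?q ^ k * psi (p * G) else 0)"
  proof (rule sum_psi_image[OF G])
    have "p * G \<in> carrier_mat k k" "b * G \<in> carrier_mat 1 k" using G by (auto intro: carrier_matI)
    thus "b * G \<noteq> 0\<^sub>m 1 k \<Longrightarrow> (\<Sum>x\<in>carrier_mat k 1. psi (p * G + x * (b * G))) = (0 :: 'k)"
      by (rule sum_psi_rank_one_perturbation)
  qed
  finally have "?q ^ k * (\<Sum>c\<in>col_image G. psi (G * p + c * b)) = ?q ^ k * (if b * G = 0\<^sub>m 1 k
      then ?q ^ mat_rank (Suc k) G * psi (p * G) else 0)" by simp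
  moreover have "?q ^ k \<noteq> 0" using q by simp
  ultimately show ?thesis by (simp only: mult_cancel_left) simp
qed

lemma rank_mult_p:
  assumes G: "G \<in> carrier_mat (Suc k) k" and "b * G = 0\<^sub>m 1 k"
  shows "mat_rank k (p * G) = mat_rank (Suc k) G"
proof (rule antisym)
  show "mat_rank k (p * G) \<le> mat_rank (Suc k) G"
    by (rule mat_rank_mult_le_right[OF carrier(2) G])
  have "p * G \<in> carrier_mat k k" using G by (intro carrier_matI) auto
  from mat_rank_mult_le_right[OF carrier(1) this]
  show "mat_rank (Suc k) G \<le> mat_rank k (p * G)" using eq_s_mult_p[of G] assms by simp
qed

text \<open>The weight takes one value for \<open>c\<close> inside the image of \<open>G\<close> and
  another outside. As the unweighted total vanishes, the difference of the two values times the
  inside sum remains.\<close>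

lemma sum_weighted_psi:
  assumes q: "of_nat (card (UNIV :: 'a set)) \<noteq> (0 :: 'k::field)" and G: "G \<in> carrier_mat (Suc k) k"
    and "r < k"
  shows "(\<Sum>c\<in>carrier_mat (Suc k) 1. psi (G * p + c * b) *
      rank_weight (card (UNIV :: 'a set)) (Suc k) r (mat_rank (Suc k) (G * p + c * b))) =
    (if b * G = 0\<^sub>m 1 k then of_nat (card (UNIV :: 'a set)) ^ r *
      (psi (p * G) * rank_weight (card (UNIV :: 'a set)) k r (mat_rank k (p * G))) else (0 :: 'k))"
proof -
  let ?q = "card (UNIV :: 'a set)"
  let ?w = "rank_weight ?q (Suc k) r :: nat \<Rightarrow> 'k" and ?\<rho> = "mat_rank (Suc k) G"
  let ?f = "\<lambda>c. psi (G * p + c * b) :: 'k"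
  let ?In = "\<Sum>c\<in>col_image G. ?f c" and ?Out = "\<Sum>c\<in>carrier_mat (Suc k) 1 - col_image G. ?f c"
  have "G * p \<in> carrier_mat (Suc k) (Suc k)" using G by (intro carrier_matI) auto
  from sum_psi_rank_one_perturbation[OF this carrier(3) b_nonzero, where 'k='k]
  have "?In + ?Out = 0" unfolding sum_carrier_split[OF G, of ?f] .
  hence Out: "?Out = - ?In" by (simp only: eq_neg_iff_add_eq_0 add.commute)
  have "(\<Sum>c\<in>carrier_mat (Suc k) 1. ?f c * ?w (mat_rank (Suc k) (G * p + c * b))) =
      (\<Sum>c\<in>col_image G. ?f c * ?w ?\<rho>) + (\<Sum>c\<in>carrier_mat (Suc k) 1 - col_image G. ?f c * ?w (Suc ?\<rho>))"
    unfolding sum_carrier_split[OF G, of "\<lambda>c. ?f c * ?w (mat_rank (Suc k) (G * p + c * b))"]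
    using col_image_carrier[OF G] rank_append[OF G]
    by (intro arg_cong2[where f = "(+)"] sum.cong) (auto simp: subset_iff)
  also have "\<dots> = (?w ?\<rho> - ?w (Suc ?\<rho>)) * ?In"
    unfolding sum_distrib_right[symmetric] Out by (simp add: algebra_simps)
  also have "\<dots> = (if b * G = 0\<^sub>m 1 k then
      of_nat ?q ^ ?\<rho> * (?w ?\<rho> - ?w (Suc ?\<rho>)) * psi (p * G) else 0)"
    unfolding sum_psi_col_image[OF q G] by simp
  also have "of_nat ?q ^ ?\<rho> * (?w ?\<rho> - ?w (Suc ?\<rho>)) = of_nat ?q ^ r * rank_weight ?q k r ?\<rho>"
    by (rule rank_weight_diff[OF card_field_ge_2 \<open>r < k\<close>])
  finally show ?thesis using rank_mult_p[OF G] by (simp add: mult_ac)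
qed

text \<open>For \<open>r = k\<close> the weight is 1 on singular matrices and 0 on invertible ones,
  so the vanishing total merely loses the identity.\<close>

lemma sum_weighted_psi_top:
  assumes G: "G \<in> carrier_mat (Suc k) k"
  shows "(\<Sum>c\<in>carrier_mat (Suc k) 1. psi (G * p + c * b) *
      rank_weight (card (UNIV :: 'a set)) (Suc k) k (mat_rank (Suc k) (G * p + c * b))) =
    (if G = s then - mu (card (UNIV :: 'a set)) (Suc k) else (0 :: 'k::field))"
proof -
  let ?q = "card (UNIV :: 'a set)"
  have Gp: "G * p \<in> carrier_mat (Suc k) (Suc k)" using G by (intro carrier_matI) auto
  have "psi (G * p + c * b) * rank_weight ?q (Suc k) k (mat_rank (Suc k) (G * p + c * b)) =
      psi (G * p + c * b) - (if c = v then if G = s then mu ?q (Suc k) else 0 else (0 :: 'k))"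
    if c: "c \<in> carrier_mat (Suc k) 1" for c
  proof (cases "mat_rank (Suc k) (G * p + c * b) = Suc k")
    case True
    thus ?thesis using psi_full_rank[OF G c True, where 'k='k] by (auto simp: rank_weight_def)
  next
    case False
    have "G * p + c * b \<in> carrier_mat (Suc k) (Suc k)" using Gp c by (intro carrier_matI) auto
    from mat_rank_le_cols[OF this] False have "mat_rank (Suc k) (G * p + c * b) \<le> k" by simp
    hence "rank_weight ?q (Suc k) k (mat_rank (Suc k) (G * p + c * b)) = (1 :: 'k)"
      by (simp add: rank_weight_def qbinom_refl[OF card_field_ge_2])
    moreover have "\<not> (G = s \<and> c = v)"
    proof
      assume "G = s \<and> c = v"
      hence "G * p + c * b = 1\<^sub>m (Suc k)" using sum by simp
      thus False using False mat_rank_one[where 'a='a] by simp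
    qed
    ultimately show ?thesis by simp
  qed
  hence "(\<Sum>c\<in>carrier_mat (Suc k) 1. psi (G * p + c * b) *
        rank_weight ?q (Suc k) k (mat_rank (Suc k) (G * p + c * b))) =
      (\<Sum>c\<in>carrier_mat (Suc k) 1. psi (G * p + c * b)) -
      (\<Sum>c\<in>carrier_mat (Suc k) 1. if c = v then if G = s then mu ?q (Suc k) else 0 else (0 :: 'k))"
    unfolding sum_subtractf[symmetric] by (intro sum.cong refl)
  also have "\<dots> = (if G = s then - mu ?q (Suc k) else 0)"
    using sum_psi_rank_one_perturbation[OF Gp carrier(3) b_nonzero, where 'k='k] carrier(4) by simp
  finally show ?thesis .
qed

end

text \<open>There are more rows of length \<open>n\<close> than of length \<open>j\<close>, so two
  rows have the same product with \<open>B\<close>; take their difference.\<close>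

lemma ex_left_kernel:
  fixes B :: "'a::{field,finite} mat"
  assumes B: "B \<in> carrier_mat n j" and "j < n"
  obtains b where "b \<in> carrier_mat 1 n" "b \<noteq> 0\<^sub>m 1 n" "b * B = 0\<^sub>m 1 j"
proof -
  let ?f = "\<lambda>b. b * B"
  have "card (UNIV :: 'a set) ^ j < card (UNIV :: 'a set) ^ n"
    using card_field_ge_2[where 'a='a] \<open>j < n\<close> by simp
  hence "card (carrier_mat 1 j :: 'a mat set) < card (carrier_mat 1 n :: 'a mat set)"
    by (simp add: card_carrier_mat)
  moreover have "?f ` carrier_mat 1 n \<subseteq> carrier_mat 1 j" using B by auto
  ultimately have "\<not> inj_on ?f (carrier_mat 1 n)"
    using card_inj_on_le[of ?f "carrier_mat 1 n" "carrier_mat 1 j"] by (auto simp del: One_nat_def)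
  then obtain x y where xy: "x \<in> carrier_mat 1 n" "y \<in> carrier_mat 1 n" "x * B = y * B" "x \<noteq> y"
    unfolding inj_on_def by blast
  show ?thesis
  proof
    show "x - y \<in> carrier_mat 1 n" using xy by auto
    show "(x - y) * B = 0\<^sub>m 1 j"
      unfolding minus_mult_distrib_mat[OF xy(1,2) B] xy(3) using xy B by (auto intro!: eq_matI)
    show "x - y \<noteq> 0\<^sub>m 1 n"
    proof
      assume *: "x - y = 0\<^sub>m 1 n"
      have "x $$ (i, j) = y $$ (i, j)" if "i < 1" "j < n" for i j
        using arg_cong[OF *, of "\<lambda>A. A $$ (i, j)"] that xy by simp
      hence "x = y" using xy by (intro eq_matI) auto
      thus False using xy by simp
    qed
  qed
qed

text \<open>Choose a nonzero \<open>b\<close> with \<open>b * B = 0\<close>. Then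
  \<open>m * B\<close> depends only on the restriction \<open>G\<close> of \<open>m\<close> to the
  kernel of \<open>b\<close>, and the sum over the remaining column is known. At
  \<open>r = n - 1\<close> only \<open>G = s\<close> survives; before that \<open>G = s * X\<close>,
  and each descent to \<open>X\<close> contributes \<open>q ^ r\<close>.\<close>

lemma sum_psi_rank_weight:
  fixes B :: "'a::{field,finite} mat" and \<Phi> :: "'a mat \<Rightarrow> 'k::field"
  assumes q: "of_nat (card (UNIV :: 'a set)) \<noteq> (0 :: 'k)"
    and "B \<in> carrier_mat n j" "j \<le> r" "r < n"
  shows "(\<Sum>m\<in>carrier_mat n n. psi m * rank_weight (card (UNIV :: 'a set)) n r (mat_rank n m) * \<Phi> (m * B)) =
    of_nat (card (UNIV :: 'a set)) ^ (r * (n - 1 - r)) * - mu (card (UNIV :: 'a set)) (Suc r) * \<Phi> B"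
  using assms(2-)
proof (induction n arbitrary: B \<Phi>)
  case (Suc k)
  let ?q = "card (UNIV :: 'a set)"
  obtain b where b: "b \<in> carrier_mat 1 (Suc k)" "b \<noteq> 0\<^sub>m 1 (Suc k)" "b * B = 0\<^sub>m 1 j"
    using ex_left_kernel[OF Suc.prems(1)] Suc.prems by auto
  obtain s p v where "splitting k s p b v" using ex_splitting_row[OF b(1,2)] .
  then interpret finite_splitting k s p b v by (rule finite_splitting.intro)
  define B' where "B' = p * B"
  have B': "B' \<in> carrier_mat k j" using Suc.prems by (auto simp: B'_def intro: carrier_matI)
  have sB': "s * B' = B" unfolding B'_def by (rule eq_s_mult_p) (use b(3) Suc.prems in auto)
  have bB: "b * (s * B') = 0\<^sub>m 1 j" using b(3) sB' by simp
  have mB: "(G * p + c * b) * B = G * B'"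
    if "G \<in> carrier_mat (Suc k) k" "c \<in> carrier_mat (Suc k) 1" for G c
    using that B' unfolding sB'[symmetric] by (simp add: splitting_simps)
  define W where "W = (\<lambda>G. \<Sum>c\<in>carrier_mat (Suc k) 1. psi (G * p + c * b) *
      rank_weight ?q (Suc k) r (mat_rank (Suc k) (G * p + c * b)) :: 'k)"
  have "(\<Sum>m\<in>carrier_mat (Suc k) (Suc k). psi m * rank_weight ?q (Suc k) r (mat_rank (Suc k) m) * \<Phi> (m * B)) =
      (\<Sum>G\<in>carrier_mat (Suc k) k. W G * \<Phi> (G * B'))"
    unfolding sum_decompose_right W_def sum_distrib_right by (intro sum.cong refl) (simp add: mB)
  also have "\<dots> = of_nat ?q ^ (r * (Suc k - 1 - r)) * - mu ?q (Suc r) * \<Phi> B"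
  proof (cases "r = k")
    case True
    have "W G = (if G = s then - mu ?q (Suc k) else 0)" if "G \<in> carrier_mat (Suc k) k" for G
      unfolding W_def True by (rule sum_weighted_psi_top[OF that])
    hence "(\<Sum>G\<in>carrier_mat (Suc k) k. W G * \<Phi> (G * B')) =
        (\<Sum>G\<in>carrier_mat (Suc k) k. if G = s then - mu ?q (Suc k) * \<Phi> (G * B') else 0)"
      by (intro sum.cong refl) simp
    also have "\<dots> = - mu ?q (Suc k) * \<Phi> B" using carrier(1) sB' by simp
    finally show ?thesis using True by simp
  next
    case False
    hence r: "r < k" using Suc.prems by simp
    let ?V = "\<lambda>m. psi m * rank_weight ?q k r (mat_rank k m) :: 'k"
    have "W G = (if b * G = 0\<^sub>m 1 k then of_nat ?q ^ r * ?V (p * G) else 0)"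
      if "G \<in> carrier_mat (Suc k) k" for G
      unfolding W_def by (rule sum_weighted_psi[OF q that r])
    hence "(\<Sum>G\<in>carrier_mat (Suc k) k. W G * \<Phi> (G * B')) =
        (\<Sum>G\<in>carrier_mat (Suc k) k. if b * G = 0\<^sub>m 1 k then of_nat ?q ^ r * ?V (p * G) * \<Phi> (G * B') else 0)"
      by (intro sum.cong refl) simp
    \<comment> \<open>In coordinates \<open>G = s * X + v * Y\<close> the condition reads
      \<open>Y = 0\<close>, and then \<open>p * G = X\<close>.\<close>
    also have "\<dots> = (\<Sum>X\<in>carrier_mat k k. \<Sum>Y\<in>(carrier_mat 1 k :: 'a mat set).
        if Y = 0\<^sub>m 1 k then of_nat ?q ^ r * ?V X * \<Phi> (s * (X * B')) else 0)"
      unfolding sum_decompose_left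
    proof (intro sum.cong refl)
      fix X Y :: "'a mat" assume X: "X \<in> carrier_mat k k" and Y: "Y \<in> carrier_mat 1 k"
      have pXY: "p * (s * X + v * Y) = X" and bXY: "b * (s * X + v * Y) = Y"
        using X Y by (simp_all add: splitting_simps)
      have "(s * X + v * Y) * B' = s * (X * B')" if "Y = 0\<^sub>m 1 k"
        using X B' unfolding that by (simp add: splitting_simps)
      thus "(if b * (s * X + v * Y) = 0\<^sub>m 1 k then of_nat ?q ^ r * ?V (p * (s * X + v * Y)) *
          \<Phi> ((s * X + v * Y) * B') else 0) =
        (if Y = 0\<^sub>m 1 k then of_nat ?q ^ r * ?V X * \<Phi> (s * (X * B')) else 0)"
        unfolding pXY bXY by simp
    qed
    also have "\<dots> = of_nat ?q ^ r * (\<Sum>X\<in>carrier_mat k k. ?V X * \<Phi> (s * (X * B')))"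
      by (simp add: sum_distrib_left mult.assoc)
    \<comment> \<open>The function in the induction hypothesis absorbs the left factor
      \<open>s\<close>; this is why \<Phi> is generalized.\<close>
    also have "\<dots> = of_nat ?q ^ r * (of_nat ?q ^ (r * (k - 1 - r)) * - mu ?q (Suc r) * \<Phi> (s * B'))"
      using Suc.IH[OF B' \<open>j \<le> r\<close> r, of "\<lambda>Z. \<Phi> (s * Z)"] by simp
    also have "\<dots> = of_nat ?q ^ (r * (Suc k - 1 - r)) * - mu ?q (Suc r) * \<Phi> B"
    proof -
      have "Suc k - 1 - r = Suc (k - 1 - r)" using r by simp
      thus ?thesis by (simp add: sB' power_add mult_ac)
    qed
    finally show ?thesis .
  qed
  finally show ?case .
qed simp

subsection \<open>The unit\<close>

text \<open>The two values of \<open>mu\<close> multiply to \<open>- q ^ (r * r)\<close>, and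
  \<open>r * r + r * (n - 1 - r) = (n - 1) * r\<close>.\<close>

lemma eta_normalization:
  assumes q: "of_nat q \<noteq> (0 :: 'k::field)" and "r < n"
  shows "inverse (of_nat q ^ ((n - 1) * r)) * mu q r *
    (of_nat q ^ (r * (n - 1 - r)) * - mu q (Suc r)) = (1 :: 'k)"
proof -
  obtain d where n: "n = Suc (r + d)" using \<open>r < n\<close> less_imp_Suc_add by blast
  have "even (r * (r - 1))" by (cases r) auto
  hence "(r choose 2) + (r choose 2) = r * (r - 1)" unfolding choose_two by presburger
  hence c: "r + ((r choose 2) + (r choose 2)) = r * r" by (cases r) auto
  have "mu q r * - mu q (Suc r) = of_nat q ^ r * (of_nat q ^ (r choose 2) * of_nat q ^ (r choose 2) * ((-1) ^ r * (-1) ^ r) :: 'k)"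
    unfolding mu_Suc by (simp add: mu_def mult_ac)
  also have "\<dots> = (of_nat q ^ (r * r) :: 'k)"
    unfolding c[symmetric] power_add by (simp flip: power_add mult_2 power_mult)
  finally have m: "mu q r * - mu q (Suc r) = (of_nat q ^ (r * r) :: 'k)" .
  have "inverse (of_nat q ^ ((n - 1) * r)) * mu q r * (of_nat q ^ (r * (n - 1 - r)) * - mu q (Suc r)) =
      inverse (of_nat q ^ ((n - 1) * r)) * (of_nat q ^ (r * (n - 1 - r)) * (mu q r * - mu q (Suc r)) :: 'k)"
    by (simp only: mult_ac)
  also have "\<dots> = inverse (of_nat q ^ (r * r + r * d)) * (of_nat q ^ (r * r + r * d) :: 'k)"
    unfolding m using n by (simp add: power_add algebra_simps)
  also have "\<dots> = 1" using q by simp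
  finally show ?thesis .
qed

lemma eta_eq_psi:
  assumes "m \<in> carrier_mat n n"
  shows "(eta TYPE('f::{field,finite}) n r m :: 'k::field) =
    inverse (of_nat (card (UNIV :: 'f set)) ^ ((n - 1) * r)) * mu (card (UNIV :: 'f set)) r *
    (psi m * rank_weight (card (UNIV :: 'f set)) n r (mat_rank n m))"
  using assms by (simp add: eta_def psi_def rank_weight_def)

text \<open>With the constraint as an indicator, the inner sum for fixed \<open>y\<close> has the
  form of a sum of \<open>a x\<close> times a function of \<open>x * y\<close>.\<close>

lemma conv_eq_sum:
  fixes a b :: "'f::{field,finite} mat \<Rightarrow> 'k::field"
  shows "conv n a b z = (\<Sum>y\<in>carrier_mat n n. \<Sum>x\<in>carrier_mat n n. a x * b y * of_bool (x * y = z))"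
proof -
  have "conv n a b z = (\<Sum>(x, y)\<in>{(x, y). x \<in> carrier_mat n n \<and> y \<in> carrier_mat n n \<and> x * y = z}. a x * b y)"
    by (simp add: conv_def case_prod_unfold)
  also have "\<dots> = (\<Sum>(x, y)\<in>carrier_mat n n \<times> carrier_mat n n. a x * b y * of_bool (x * y = z))"
    by (rule sum.mono_neutral_cong_left) auto
  also have "\<dots> = (\<Sum>x\<in>carrier_mat n n. \<Sum>y\<in>carrier_mat n n. a x * b y * of_bool (x * y = z))"
    by (rule sum.cartesian_product[symmetric])
  also have "\<dots> = (\<Sum>y\<in>carrier_mat n n. \<Sum>x\<in>carrier_mat n n. a x * b y * of_bool (x * y = z))"
    by (rule sum.swap)
  finally show ?thesis .
qed

section \<open>Transposition as an anti-automorphism of the monoid algebra\<close>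

lemma conv_transpose:
  fixes a b :: "'f::{field,finite} mat \<Rightarrow> 'k::field"
  shows "conv n a b (transpose_mat z) = conv n (b \<circ> transpose_mat) (a \<circ> transpose_mat) z"
proof -
  have T: "transpose_mat y * transpose_mat x = transpose_mat (x * y)"
    if "x \<in> carrier_mat n n" "y \<in> carrier_mat n n" for x y :: "'f mat"
    using transpose_mult[OF that] by simp
  show ?thesis
    unfolding conv_def
    by (rule sum.reindex_bij_witness[where i = "\<lambda>(x, y). (transpose_mat y, transpose_mat x)"
          and j = "\<lambda>(x, y). (transpose_mat y, transpose_mat x)"])
      (auto simp: T mult.commute)
qed

lemma transpose_pow_mat:
  fixes m :: "'a::comm_semiring_1 mat"
  assumes "m \<in> carrier_mat n n"
  shows "transpose_mat m ^\<^sub>m i = transpose_mat (m ^\<^sub>m i)"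
proof (induction i)
  case (Suc i)
  have "transpose_mat (m ^\<^sub>m Suc i) = transpose_mat m * transpose_mat (m ^\<^sub>m i)"
    using transpose_mult[of "m ^\<^sub>m i" n n m n] assms by simp
  thus ?case using Suc pow_mat_commute[of "transpose_mat m" n i] assms by simp
qed (use assms in simp)

lemma semi_idempotent_transpose_imp:
  fixes m :: "'a::field mat"
  assumes m: "m \<in> carrier_mat n n" and "semi_idempotent m"
  shows "semi_idempotent (transpose_mat m)"
proof -
  obtain N where N: "m * m ^\<^sub>m N = m ^\<^sub>m N" using assms by (auto simp: semi_idempotent_def)
  have "transpose_mat m * transpose_mat m ^\<^sub>m N = transpose_mat (m ^\<^sub>m N * m)"
    using transpose_mult[of "m ^\<^sub>m N" n n m n] m by (simp add: transpose_pow_mat)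
  also have "\<dots> = transpose_mat m ^\<^sub>m N" using N m by (simp add: pow_mat_commute transpose_pow_mat)
  finally show ?thesis unfolding semi_idempotent_def by blast
qed

lemma semi_idempotent_transpose:
  fixes m :: "'a::field mat"
  assumes "m \<in> carrier_mat n n"
  shows "semi_idempotent (transpose_mat m) \<longleftrightarrow> semi_idempotent m"
  using semi_idempotent_transpose_imp[OF assms] semi_idempotent_transpose_imp[of "transpose_mat m" n] assms
  by auto

lemma stable_rank_transpose:
  fixes m :: "'a::{field,finite} mat"
  assumes "m \<in> carrier_mat n n"
  shows "stable_rank n (transpose_mat m) = stable_rank n m"
  unfolding stable_rank_def using assms by (simp add: transpose_pow_mat mat_rank_transpose[of _ n n])

lemma eta_transpose: "eta TYPE('f::{field,finite}) n r \<circ> transpose_mat = (eta TYPE('f) n r :: 'f mat \<Rightarrow> 'k::field)"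
proof
  fix m :: "'f mat"
  show "(eta TYPE('f) n r \<circ> transpose_mat) m = (eta TYPE('f) n r m :: 'k)"
    by (cases "m \<in> carrier_mat n n")
      (simp_all add: eta_def semi_idempotent_transpose stable_rank_transpose mat_rank_transpose)
qed

lemma rank_ideal_transpose:
  fixes x :: "'f::{field,finite} mat \<Rightarrow> 'k::field"
  assumes "x \<in> rank_ideal n r"
  shows "x \<circ> transpose_mat \<in> rank_ideal n r"
  using assms by (auto simp: rank_ideal_def monoid_alg_def mat_rank_transpose)

lemma eta_in_rank_ideal: "(eta TYPE('f::{field,finite}) n r :: 'f mat \<Rightarrow> 'k::field) \<in> rank_ideal n r"
  by (auto simp: rank_ideal_def monoid_alg_def eta_def)

text \<open>Factoring \<open>y = B * C\<close> gives a \<open>B\<close> with at most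
  \<open>r\<close> columns; right multiplication by \<open>C\<close> is absorbed into
  \<Phi>.\<close>

lemma sum_eta_mult:
  fixes y :: "'f::{field,finite} mat" and \<Phi> :: "'f mat \<Rightarrow> 'k::field"
  assumes q: "of_nat (card (UNIV :: 'f set)) \<noteq> (0 :: 'k)" and "r < n"
    and y: "y \<in> carrier_mat n n" "mat_rank n y \<le> r"
  shows "(\<Sum>m\<in>carrier_mat n n. eta TYPE('f) n r m * \<Phi> (m * y)) = \<Phi> y"
proof -
  let ?q = "card (UNIV :: 'f set)"
  let ?c = "inverse (of_nat ?q ^ ((n - 1) * r)) * mu ?q r :: 'k"
  obtain B C where BC: "B \<in> carrier_mat n (mat_rank n y)" "C \<in> carrier_mat (mat_rank n y) n" "y = B * C"
    using rank_factorization[OF y(1)] by metis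
  have "(\<Sum>m\<in>carrier_mat n n. eta TYPE('f) n r m * \<Phi> (m * y)) =
      (\<Sum>m\<in>carrier_mat n n. ?c * (psi m * rank_weight ?q n r (mat_rank n m) * \<Phi> ((m * B) * C)))"
  proof (intro sum.cong refl)
    fix m :: "'f mat" assume m: "m \<in> carrier_mat n n"
    have "m * y = (m * B) * C" unfolding BC(3) by (rule assoc_mult_mat[symmetric, OF m BC(1,2)])
    thus "eta TYPE('f) n r m * \<Phi> (m * y) =
        ?c * (psi m * rank_weight ?q n r (mat_rank n m) * \<Phi> ((m * B) * C))"
      unfolding eta_eq_psi[OF m] by (simp only: mult.assoc)
  qed
  also have "\<dots> = ?c * (of_nat ?q ^ (r * (n - 1 - r)) * - mu ?q (Suc r) * \<Phi> (B * C))"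
    unfolding sum_distrib_left[symmetric]
    using sum_psi_rank_weight[OF q BC(1) y(2) \<open>r < n\<close>, of "\<lambda>Z. \<Phi> (Z * C)"] by simp
  also have "\<dots> = ?c * (of_nat ?q ^ (r * (n - 1 - r)) * - mu ?q (Suc r)) * \<Phi> y"
    unfolding BC(3)[symmetric] by (simp only: mult.assoc)
  also have "\<dots> = \<Phi> y" unfolding eta_normalization[OF q \<open>r < n\<close>] by simp
  finally show ?thesis .
qed

text \<open>For each \<open>y\<close> in the support of \<open>x\<close>,
  \<open>sum_eta_mult\<close> is applied to the indicator of \<open>z\<close>.\<close>

lemma conv_eta_left:
  fixes x :: "'f::{field,finite} mat \<Rightarrow> 'k::field"
  assumes q: "of_nat (card (UNIV :: 'f set)) \<noteq> (0 :: 'k)" and "r < n" and x: "x \<in> rank_ideal n r"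
  shows "conv n (eta TYPE('f) n r) x = x"
proof
  fix z :: "'f mat"
  have "conv n (eta TYPE('f) n r) x z = (\<Sum>y\<in>carrier_mat n n. x y *
      (\<Sum>m\<in>carrier_mat n n. eta TYPE('f) n r m * of_bool (m * y = z)))"
    unfolding conv_eq_sum by (simp only: sum_distrib_left mult_ac)
  also have "\<dots> = (\<Sum>y\<in>carrier_mat n n. x y * of_bool (y = z))"
  proof (intro sum.cong refl)
    fix y :: "'f mat" assume y: "y \<in> carrier_mat n n"
    show "x y * (\<Sum>m\<in>carrier_mat n n. eta TYPE('f) n r m * of_bool (m * y = z)) = x y * of_bool (y = z)"
    proof (cases "mat_rank n y \<le> r")
      case True
      thus ?thesis using sum_eta_mult[OF q \<open>r < n\<close> y, of "\<lambda>w. of_bool (w = z)"] by simp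
    next
      case False
      hence "x y = 0" using x y by (auto simp: rank_ideal_def)
      thus ?thesis by simp
    qed
  qed
  also have "\<dots> = x z"
    using x by (cases "z \<in> carrier_mat n n") (auto simp: rank_ideal_def monoid_alg_def)
  finally show "conv n (eta TYPE('f) n r) x z = x z" .
qed

theorem theorem4p1:
  fixes n r :: nat
  assumes "n \<ge> 1"
    and "(of_nat (card (UNIV :: 'f::{field,finite} set)) :: 'k::field) \<noteq> 0"
    and "r \<le> n - 1"
  shows "is_unit_of_ideal n (rank_ideal n r :: ('f mat \<Rightarrow> 'k) set) (eta TYPE('f) n r)"
  unfolding is_unit_of_ideal_def
proof (intro conjI ballI)
  have "r < n" using assms by simp
  show "eta TYPE('f) n r \<in> (rank_ideal n r :: ('f mat \<Rightarrow> 'k) set)" by (rule eta_in_rank_ideal)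
  fix x :: "'f mat \<Rightarrow> 'k" assume x: "x \<in> rank_ideal n r"
  show "conv n (eta TYPE('f) n r) x = x" by (rule conv_eta_left[OF assms(2) \<open>r < n\<close> x])
  show "conv n x (eta TYPE('f) n r) = x"
  proof
    fix z :: "'f mat"
    \<comment> \<open>Transposition fixes \<open>eta\<close> and reverses convolution, so the right
      unit law follows from the left one.\<close>
    have "conv n x (eta TYPE('f) n r) z = conv n (eta TYPE('f) n r) (x \<circ> transpose_mat) (transpose_mat z)"
      using conv_transpose[of n x "eta TYPE('f) n r" "transpose_mat z"] by (simp add: eta_transpose)
    also have "\<dots> = x z"
      unfolding conv_eta_left[OF assms(2) \<open>r < n\<close> rank_ideal_transpose[OF x]] by simp
    finally show "conv n x (eta TYPE('f) n r) z = x z" .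
  qed
qed

end
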